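(* Let $t\ge 0$ be an integer. Then $\mathcal{U}(3k-t,k+2t)\leq t$ for every integer $k\geq\frac{5}{8}t$.
   Context: All point sets are in general position (no three collinear). An $(r,b)$-set is a set $S=R\cup B$ of $r$ red points and $b$ blue points in general position. A subset $X\subseteq S$ can be $K_{1,3}$-covered if $X$ can be partitioned into subsets of size $4$, each consisting of one point (the center) of one color and three points of the other color, such that the straight-line segments joining each center to the three other points of its subset are pairwise non-crossing (no two intersect except at a common endpoint). $\mathcal{C}(S)$ is the maximum size of a subset of $S$ that can be $K_{1,3}$-covered, $\mathcal{U}(S)=|S|-\mathcal{C}(S)$, and $\mathcal{U}(r,b)$ is the maximum of $\mathcal{U}(S)$ over all $(r,b)$-sets $S$. *)

theory Defs
  imports "HOL-Analysis.Analysis" "HOL-Library.Disjoint_Sets"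
begin

type_synonym point = "real ^ 2"

definition general_position :: "point set \<Rightarrow> bool" where
  "general_position S \<longleftrightarrow>
     (\<forall>p\<in>S. \<forall>q\<in>S. \<forall>s\<in>S. p \<noteq> q \<longrightarrow> p \<noteq> s \<longrightarrow> q \<noteq> s \<longrightarrow> \<not> collinear {p, q, s})"

definition rb_set :: "nat \<Rightarrow> nat \<Rightarrow> point set \<Rightarrow> point set \<Rightarrow> bool" where
  "rb_set r b R B \<longleftrightarrow>
     finite R \<and> finite B \<and> R \<inter> B = {} \<and> card R = r \<and> card B = b \<and> general_position (R \<union> B)"

definition K13_part :: "point set \<Rightarrow> point set \<Rightarrow> point \<Rightarrow> point set \<Rightarrow> bool" where
  "K13_part R B c Y \<longleftrightarrow>
     card Y = 4 \<and> c \<in> Y \<and> (c \<in> R \<and> Y - {c} \<subseteq> B \<or> c \<in> B \<and> Y - {c} \<subseteq> R)"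

text \<open>A pair of points in \<open>E\<close> stands for the straight-line segment joining them.\<close>

definition noncrossing :: "(point \<times> point) set \<Rightarrow> bool" where
  "noncrossing E \<longleftrightarrow>
     pairwise (\<lambda>(p, q) (u, v). closed_segment p q \<inter> closed_segment u v \<subseteq> {p, q} \<inter> {u, v}) E"

text \<open>The function \<open>ctr\<close> selects the center of each part of the partition; non-crossing is
  required of the edges of all the stars taken together.\<close>

definition K13_coverable :: "point set \<Rightarrow> point set \<Rightarrow> point set \<Rightarrow> bool" where
  "K13_coverable R B X \<longleftrightarrow>
     (\<exists>P ctr. partition_on X P \<and> (\<forall>Y\<in>P. K13_part R B (ctr Y) Y) \<and>
        noncrossing {(ctr Y, p) | Y p. Y \<in> P \<and> p \<in> Y - {ctr Y}})"

definition max_covered :: "point set \<Rightarrow> point set \<Rightarrow> nat" where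
  "max_covered R B = Max {card X | X. X \<subseteq> R \<union> B \<and> K13_coverable R B X}"

definition uncovered :: "point set \<Rightarrow> point set \<Rightarrow> nat" where
  "uncovered R B = card (R \<union> B) - max_covered R B"

definition max_uncovered :: "nat \<Rightarrow> nat \<Rightarrow> nat" where
  "max_uncovered r b = Max {uncovered R B | R B. rb_set r b R B}"

end

theory Submission
  imports Defs
begin

text \<open>
  If there are at least three red points per blue point (or vice versa), an assignment of three leaves
  to every center of minimal total length is noncrossing, since uncrossing two edges shortens it.
  In general one shows by induction on \<open>k\<close> that \<open>3 * k - t\<close> red and \<open>k + 2 * t\<close> blue points
  contain \<open>k\<close> noncrossing stars whenever \<open>t \<le> 2 * k\<close>. For \<open>t = 0\<close> or \<open>k \<le> t\<close> one may discard points
  to reach the one-centered situation. For \<open>0 < t < k\<close> there is a line splitting the points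
  into two smaller instances. To find it, rotate lines: for a fixed number \<open>b\<close> of blue points on the
  left, the number of red points on the left takes all intermediate values. If no splitting line
  exists, then for small \<open>a\<close> all lines with \<open>a\<close> blue points on the left have more than \<open>3 * a\<close> red
  points there, and for some \<open>p\<close> all have less; lines through two points of the same color give a
  contradiction unless \<open>p = 1\<close>, in which case three blue points come first in every direction and a
  single sweep passes through a splitting line.
\<close>

section \<open>Cutting a planar point set by a line\<close>

text \<open>No point of \<open>S\<close> lies on the line, so complements of cuts are cuts. The
  normal vector \<open>u\<close> may be \<open>0\<close>, which turns the empty set and
  \<open>S\<close> itself into cuts.\<close>

definition halfplane_cut :: "point set \<Rightarrow> point set \<Rightarrow> bool" where
  "halfplane_cut S X \<longleftrightarrow> (\<exists>u c. X = {x \<in> S. u \<bullet> x < c} \<and> (\<forall>x\<in>S. u \<bullet> x \<noteq> c))"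

lemma exists_strictly_below_finite:
  fixes h :: "'a \<Rightarrow> real"
  assumes "finite F" "\<And>x. x \<in> F \<Longrightarrow> a < h x"
  obtains c where "a < c" "\<And>x. x \<in> F \<Longrightarrow> c < h x"
proof -
  have "\<exists>c>a. \<forall>x\<in>F. c < h x"
    using assms
  proof (induction F)
    case empty
    then show ?case using gt_ex by auto
  next
    case (insert y F)
    then obtain c where "a < c" "\<forall>x\<in>F. c < h x" by auto
    moreover obtain d where "a < d" "d < h y" using insert.prems dense[of a "h y"] by auto
    ultimately show ?case by (intro exI[of _ "min c d"]) auto
  qed
  then show thesis using that by blast
qed

lemma cut_complement:
  assumes "halfplane_cut S X" shows "halfplane_cut S (S - X)"
proof -
  obtain u c where X: "X = {x \<in> S. u \<bullet> x < c}" "\<forall>x\<in>S. u \<bullet> x \<noteq> c"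
    using assms unfolding halfplane_cut_def by blast
  then have "S - X = {x \<in> S. (-u) \<bullet> x < -c}" by force
  moreover have "\<forall>x\<in>S. (-u) \<bullet> x \<noteq> -c" using X by auto
  ultimately show ?thesis unfolding halfplane_cut_def by blast
qed

lemma cut_le:
  assumes "finite S" shows "halfplane_cut S {x \<in> S. u \<bullet> x \<le> c}"
proof -
  have "finite {x \<in> S. c < u \<bullet> x}" using assms by simp
  then obtain d where d: "c < d" "\<And>x. x \<in> {x \<in> S. c < u \<bullet> x} \<Longrightarrow> d < u \<bullet> x"
    by (rule exists_strictly_below_finite[where h = "(\<bullet>) u"]) auto
  then have "{x \<in> S. u \<bullet> x \<le> c} = {x \<in> S. u \<bullet> x < d}" "\<forall>x\<in>S. u \<bullet> x \<noteq> d" by force+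
  then show ?thesis unfolding halfplane_cut_def by blast
qed

lemma cut_less:
  assumes "finite S" shows "halfplane_cut S {x \<in> S. u \<bullet> x < c}"
proof -
  have "{x \<in> S. u \<bullet> x < c} = S - {x \<in> S. - u \<bullet> x \<le> - c}" by auto
  then show ?thesis using cut_complement[OF cut_le[OF assms, of "- u" "- c"]] by simp
qed

section \<open>Level lines and sweeps in a given direction\<close>

definition perp :: "point \<Rightarrow> point" where
  "perp u = vector [- u $ 2, u $ 1]"

lemma orthogonal_imp_parallel_perp:
  fixes u d :: point
  assumes "u \<noteq> 0" "u \<bullet> d = 0"
  shows "d = ((perp u \<bullet> d) / (u \<bullet> u)) *\<^sub>R perp u"
proof -
  have uu: "u \<bullet> u > 0" using assms(1) by simp
  have uu': "u \<bullet> u = u$1 * u$1 + u$2 * u$2" by (simp add: inner_vec_def sum_2)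
  have ud: "u$1 * d$1 + u$2 * d$2 = 0" using assms(2) by (simp add: inner_vec_def sum_2)
  have pd: "perp u \<bullet> d = u$1 * d$2 - u$2 * d$1" by (simp add: inner_vec_def sum_2 perp_def)
  have "(u \<bullet> u) * d$1 = (perp u \<bullet> d) * (- u$2)" "(u \<bullet> u) * d$2 = (perp u \<bullet> d) * u$1"
    unfolding uu' pd using ud by algebra+
  then have "d$1 = (perp u \<bullet> d) / (u \<bullet> u) * (- u$2)" "d$2 = (perp u \<bullet> d) / (u \<bullet> u) * u$1"
    using uu by (simp_all add: field_simps)
  then show ?thesis by (simp add: vec_eq_iff forall_2 perp_def)
qed

lemma collinear_level_line:
  fixes u x y z :: point
  assumes "u \<noteq> 0" "u \<bullet> x = u \<bullet> y" "u \<bullet> x = u \<bullet> z"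
  shows "collinear {x, y, z}"
proof -
  have "\<exists>c. a - b = c *\<^sub>R perp u" if "u \<bullet> a = u \<bullet> b" for a b
    using orthogonal_imp_parallel_perp[OF assms(1), of "a - b"] that
    by (metis inner_diff_right right_minus_eq)
  then show ?thesis
    unfolding collinear_def using assms by (intro exI[of _ "perp u"]) auto
qed

lemma level_line_at_most_two:
  assumes "general_position S" "u \<noteq> 0" "x \<in> S" "y \<in> S" "z \<in> S"
    "u \<bullet> x = u \<bullet> y" "u \<bullet> x = u \<bullet> z" "x \<noteq> y" "x \<noteq> z"
  shows "y = z"
  using assms collinear_level_line unfolding general_position_def by metis

text \<open>Add a small positive multiple of \<open>perp u\<close> to \<open>u\<close>. Strict
  inequalities survive by continuity, and ties are broken because distinct points on a level line of
  \<open>u\<close> differ along \<open>perp u\<close>.\<close>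

lemma exists_injective_direction:
  fixes u :: point
  assumes "finite S" "u \<noteq> 0"
  obtains w where "inj_on ((\<bullet>) w) S" "\<And>x y. x \<in> S \<Longrightarrow> y \<in> S \<Longrightarrow> u \<bullet> x < u \<bullet> y \<Longrightarrow> w \<bullet> x < w \<bullet> y"
proof -
  let ?w = "\<lambda>e. u + e *\<^sub>R perp u"
  let ?P = "\<lambda>e x y. (u \<bullet> x < u \<bullet> y \<longrightarrow> ?w e \<bullet> x < ?w e \<bullet> y) \<and> (x \<noteq> y \<longrightarrow> ?w e \<bullet> x \<noteq> ?w e \<bullet> y)"
  have "eventually (\<lambda>e. ?P e x y) (at_right 0)" for x y
  proof -
    have lim: "((\<lambda>e. ?w e \<bullet> y - ?w e \<bullet> x) \<longlongrightarrow> (u + 0 *\<^sub>R perp u) \<bullet> y - (u + 0 *\<^sub>R perp u) \<bullet> x) (at_right 0)"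
      by (intro tendsto_intros)
    consider "u \<bullet> x < u \<bullet> y" | "u \<bullet> x > u \<bullet> y" | "u \<bullet> x = u \<bullet> y" by linarith
    then show ?thesis
    proof cases
      case 1
      then have "eventually (\<lambda>e. ?w e \<bullet> y - ?w e \<bullet> x > 0) (at_right 0)"
        using order_tendstoD(1)[OF lim, of 0] by simp
      then show ?thesis by eventually_elim auto
    next
      case 2
      then have "eventually (\<lambda>e. ?w e \<bullet> y - ?w e \<bullet> x < 0) (at_right 0)"
        using order_tendstoD(2)[OF lim, of 0] by simp
      then show ?thesis by eventually_elim (use 2 in auto)
    next
      case 3
      have ne: "perp u \<bullet> x \<noteq> perp u \<bullet> y" if "x \<noteq> y"
        using orthogonal_imp_parallel_perp[OF assms(2), of "x - y"] 3 that
        by (auto simp: inner_diff_right)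
      show ?thesis
        using eventually_at_right_less[of "0::real"]
        by eventually_elim (use 3 ne in \<open>auto simp: inner_add_left\<close>)
    qed
  qed
  then have "eventually (\<lambda>e. \<forall>x\<in>S. \<forall>y\<in>S. ?P e x y) (at_right 0)"
    using \<open>finite S\<close> by (simp add: eventually_ball_finite)
  from eventually_happens'[OF trivial_limit_at_right_real this] obtain e where e: "\<forall>x\<in>S. \<forall>y\<in>S. ?P e x y"
    by blast
  show thesis
    by (rule that[of "?w e"]) (use e in \<open>auto simp: inj_on_def\<close>)
qed

text \<open>Sorting by a slightly rotated injective direction makes every prefix a cut, while the
  order remains weakly increasing for \<open>u\<close> itself, even when \<open>u\<close> has
  ties.\<close>

lemma exists_sweep:
  fixes u :: point
  assumes "finite S" "u \<noteq> 0"
  obtains xs where "set xs = S" "distinct xs" "sorted (map ((\<bullet>) u) xs)" "\<And>i. halfplane_cut S (set (take i xs))"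
proof -
  obtain w where inj: "inj_on ((\<bullet>) w) S"
    and w: "\<And>x y. x \<in> S \<Longrightarrow> y \<in> S \<Longrightarrow> u \<bullet> x < u \<bullet> y \<Longrightarrow> w \<bullet> x < w \<bullet> y"
    using exists_injective_direction[OF assms] by blast
  obtain ys where ys: "set ys = S" "distinct ys" using finite_distinct_list[OF assms(1)] by blast
  define xs where "xs = sort_key ((\<bullet>) w) ys"
  have xs: "set xs = S" "distinct xs" "sorted (map ((\<bullet>) w) xs)" using ys by (auto simp: xs_def)
  have less: "w \<bullet> (xs ! i) < w \<bullet> (xs ! j)" if "i < j" "j < length xs" for i j
  proof -
    have "w \<bullet> (xs ! i) \<le> w \<bullet> (xs ! j)"
      using sorted_nth_mono[OF xs(3), of i j] that by simp
    moreover have "xs ! i \<noteq> xs ! j" using xs(2) that by (simp add: nth_eq_iff_index_eq)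
    ultimately show ?thesis
      using inj xs(1) that by (auto simp: inj_on_def less_le)
  qed
  have "sorted (map ((\<bullet>) u) xs)"
    unfolding sorted_iff_nth_mono_less
  proof (intro allI impI)
    fix i j assume "i < j" "j < length (map ((\<bullet>) u) xs)"
    then show "map ((\<bullet>) u) xs ! i \<le> map ((\<bullet>) u) xs ! j"
      using less[of i j] w[of "xs ! j" "xs ! i"] xs(1) by (force simp: not_le[symmetric])
  qed
  moreover have "halfplane_cut S (set (take i xs))" for i
  proof (cases "i < length xs")
    case False
    \<comment> \<open>The prefix is all of \<open>S\<close>, cut off by the normal vector
      \<open>0\<close> and the level \<open>1\<close>.\<close>
    then show ?thesis unfolding halfplane_cut_def using xs(1)
      by (intro exI[of _ 0] exI[of _ 1]) simp
  next
    case True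
    have "set (take i xs) = {x \<in> S. w \<bullet> x < w \<bullet> (xs ! i)}"
    proof (intro equalityI subsetI)
      fix x assume "x \<in> set (take i xs)"
      then obtain j where "j < i" "x = xs ! j" using True by (auto simp: in_set_conv_nth)
      then show "x \<in> {x \<in> S. w \<bullet> x < w \<bullet> (xs ! i)}" using less[of j i] True xs(1) by auto
    next
      fix x assume x: "x \<in> {x \<in> S. w \<bullet> x < w \<bullet> (xs ! i)}"
      then obtain j where j: "j < length xs" "x = xs ! j" using xs(1) by (auto simp: in_set_conv_nth)
      then have "j < i" using less[of i j] x by (cases "i = j") (force simp: not_less)+
      then show "x \<in> set (take i xs)" using j True by (auto simp: in_set_conv_nth)
    qed
    then show ?thesis using cut_less[OF assms(1)] by simp
  qed
  ultimately show thesis using that xs by blast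
qed

section \<open>Counts along lists and lattice paths\<close>

lemma unit_step_intermediate_value:
  fixes f :: "nat \<Rightarrow> nat"
  assumes "\<And>n. f (Suc n) \<le> Suc (f n)" "i \<le> j" "f i \<le> r" "r \<le> f j"
  obtains m where "i \<le> m" "m \<le> j" "f m = r"
proof -
  \<comment> \<open>The first index reaching \<open>r\<close> cannot overshoot, since
    \<open>f\<close> grows by at most one per step.\<close>
  define m where "m = (LEAST m. i \<le> m \<and> r \<le> f m)"
  have m: "i \<le> m \<and> r \<le> f m" and "m \<le> j"
    unfolding m_def using assms by (auto intro: LeastI2[of _ j] Least_le)
  have "f m = r"
  proof (cases "m = i")
    case False
    then obtain n where n: "m = Suc n" "i \<le> n" using m by (metis Suc_leI le_neq_implies_less not0_implies_Suc not_less_eq_eq zero_le)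
    then have "\<not> r \<le> f n" using not_less_Least[of n "\<lambda>m. i \<le> m \<and> r \<le> f m"] m_def by auto
    then show ?thesis using assms(1)[of n] n m by simp
  qed (use m assms in auto)
  then show thesis using that m \<open>m \<le> j\<close> by blast
qed

lemma sorted_set_takeWhile:
  assumes "sorted (map f xs)" "\<And>x y. P x \<Longrightarrow> f y \<le> f x \<Longrightarrow> P y"
  shows "set (takeWhile P xs) = {x \<in> set xs. P x}"
  using assms(1)
proof (induction xs)
  case (Cons a xs)
  then show ?case using assms(2) by auto
qed simp

text \<open>Sweep in the normal direction of the cut. For normal vector \<open>0\<close> the cut is
  empty or everything, hence a prefix of any sweep.\<close>

lemma cut_is_sweep_prefix:
  assumes "finite S" "halfplane_cut S X"
  obtains xs m where "set xs = S" "distinct xs" "\<And>i. halfplane_cut S (set (take i xs))"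
    "m \<le> length xs" "X = set (take m xs)"
proof -
  obtain u c where X: "X = {x \<in> S. u \<bullet> x < c}" using assms(2) unfolding halfplane_cut_def by blast
  show thesis
  proof (cases "u = 0")
    case True
    have "axis 1 1 \<noteq> (0 :: point)" by simp
    then obtain xs :: "point list" where xs: "set xs = S" "distinct xs" "\<And>i. halfplane_cut S (set (take i xs))"
      using exists_sweep[OF assms(1)] by metis
    show thesis
      using that[OF xs, of 0] that[OF xs, of "length xs"] X True xs(1) by auto
  next
    case False
    then obtain xs where xs: "set xs = S" "distinct xs" "sorted (map ((\<bullet>) u) xs)"
      "\<And>i. halfplane_cut S (set (take i xs))"
      using exists_sweep[OF assms(1)] by metis
    have "X = set (takeWhile (\<lambda>x. u \<bullet> x < c) xs)"
      using sorted_set_takeWhile[OF xs(3), of "\<lambda>x. u \<bullet> x < c"] X xs(1) by auto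
    then show thesis
      using that[OF xs(1,2,4), of "length (takeWhile (\<lambda>x. u \<bullet> x < c) xs)"]
      by (simp add: length_takeWhile_le takeWhile_eq_take[symmetric])
  qed
qed

lemma card_take_Suc_Int:
  assumes "distinct xs" "i < length xs"
  shows "card (set (take (Suc i) xs) \<inter> A) = card (set (take i xs) \<inter> A) + (if xs ! i \<in> A then 1 else 0)"
proof -
  have "xs ! i \<notin> set (take i xs)"
    using assms by (auto simp: in_set_conv_nth nth_eq_iff_index_eq)
  then show ?thesis using assms(2) by (simp add: take_Suc_conv_app_nth Int_insert_left)
qed

lemma card_take_Int_step:
  assumes "distinct xs"
  shows "card (set (take (Suc i) xs) \<inter> A) \<le> Suc (card (set (take i xs) \<inter> A))"
  using card_take_Suc_Int[OF assms, of i A] by (cases "i < length xs") auto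

lemma card_take_Int_mono:
  "i \<le> j \<Longrightarrow> card (set (take i xs) \<inter> A) \<le> card (set (take j xs) \<inter> A)"
  by (intro card_mono) (auto dest: set_take_subset_set_take[THEN subsetD])

text \<open>The shortest prefix holding \<open>b + 1\<close> elements of \<open>A\<close> ends in
  the element sought.\<close>

lemma nth_hit_in_list:
  assumes "distinct xs" "finite A" "A \<subseteq> set xs" "b < card A"
  obtains i where "i < length xs" "xs ! i \<in> A"
    "card (set (take i xs) \<inter> A) = b" "card (set (take (Suc i) xs) \<inter> A) = Suc b"
proof -
  let ?f = "\<lambda>i. card (set (take i xs) \<inter> A)"
  define i where "i = (LEAST i. Suc b \<le> ?f i)"
  have end': "Suc b \<le> ?f (length xs)" using assms by (simp add: Int_absorb1)
  have i: "Suc b \<le> ?f i" unfolding i_def using end' by (rule LeastI)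
  have "i \<noteq> 0" using i by (cases "i = 0") auto
  then obtain n where n: "i = Suc n" using not0_implies_Suc by blast
  have "?f n < Suc b" using not_less_Least[of n "\<lambda>i. Suc b \<le> ?f i"] n i_def by simp
  moreover have "n < length xs" using Least_le[of "\<lambda>i. Suc b \<le> ?f i", OF end'] i_def n by simp
  ultimately show thesis
    using that[of n] i n card_take_Suc_Int[OF assms(1), of n A] by (auto split: if_splits)
qed

lemma nth_in_set_take: "l < n \<Longrightarrow> l < length xs \<Longrightarrow> xs ! l \<in> set (take n xs)"
  by (auto simp: in_set_conv_nth)

text \<open>Models a sweep as a lattice path: \<open>\<rho> i\<close> and \<open>\<beta> i\<close>
  stand for the numbers of red and blue points among the first \<open>i\<close> points.\<close>

definition unit_path :: "nat \<Rightarrow> (nat \<Rightarrow> nat) \<Rightarrow> (nat \<Rightarrow> nat) \<Rightarrow> bool" where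
  "unit_path n \<rho> \<beta> \<longleftrightarrow> \<rho> 0 = 0 \<and> \<beta> 0 = 0 \<and>
     (\<forall>i<n. \<rho> (Suc i) = Suc (\<rho> i) \<and> \<beta> (Suc i) = \<beta> i \<or> \<rho> (Suc i) = \<rho> i \<and> \<beta> (Suc i) = Suc (\<beta> i))"

lemma unit_path_mono:
  assumes "unit_path n \<rho> \<beta>" "i \<le> j" "j \<le> n"
  shows "\<rho> i \<le> \<rho> j \<and> \<beta> i \<le> \<beta> j"
  using assms(2,3)
proof (induction j rule: dec_induct)
  case (step j)
  then show ?case using assms(1) unfolding unit_path_def by (auto simp: Suc_le_eq le_Suc_eq dest!: spec[of _ j])
qed simp

lemma unit_path_step:
  assumes "unit_path n \<rho> \<beta>" "i < n"
  obtains (red) "\<rho> (Suc i) = Suc (\<rho> i)" "\<beta> (Suc i) = \<beta> i" | (blue) "\<rho> (Suc i) = \<rho> i" "\<beta> (Suc i) = Suc (\<beta> i)"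
  using assms unfolding unit_path_def by blast

text \<open>This is the same sweep performed from the other end.\<close>

lemma unit_path_reverse:
  assumes "unit_path n \<rho> \<beta>"
  shows "unit_path n (\<lambda>i. \<rho> n - \<rho> (n - i)) (\<lambda>i. \<beta> n - \<beta> (n - i))"
  unfolding unit_path_def
proof (intro conjI allI impI)
  fix i assume "i < n"
  then have i: "n - i = Suc (n - Suc i)" "n - Suc i < n" by auto
  then have "\<rho> (n - i) \<le> \<rho> n" "\<beta> (n - i) \<le> \<beta> n" using unit_path_mono[OF assms, of "n - i" n] by auto
  then show "\<rho> n - \<rho> (n - Suc i) = Suc (\<rho> n - \<rho> (n - i)) \<and> \<beta> n - \<beta> (n - Suc i) = \<beta> n - \<beta> (n - i) \<or>
      \<rho> n - \<rho> (n - Suc i) = \<rho> n - \<rho> (n - i) \<and> \<beta> n - \<beta> (n - Suc i) = Suc (\<beta> n - \<beta> (n - i))"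
    unfolding i(1) by (cases rule: unit_path_step[OF assms i(2)]) (auto simp: Suc_diff_Suc Suc_le_eq)
qed auto

section \<open>Numbers of red and blue points cut off by a line\<close>

locale bichromatic =
  fixes R B :: "point set"
  assumes finite_R: "finite R" and finite_B: "finite B" and disjoint: "R \<inter> B = {}"
    and general_pos: "general_position (R \<union> B)"
begin

definition cut_count :: "nat \<Rightarrow> nat \<Rightarrow> bool" where
  "cut_count r b \<longleftrightarrow> (\<exists>X. halfplane_cut (R \<union> B) X \<and> card (X \<inter> R) = r \<and> card (X \<inter> B) = b)"

lemma finite_RB: "finite (R \<union> B)"
  using finite_R finite_B by simp

lemma cut_count_complement:
  assumes "cut_count r b"
  shows "cut_count (card R - r) (card B - b)"
proof -
  obtain X where X: "halfplane_cut (R \<union> B) X" "card (X \<inter> R) = r" "card (X \<inter> B) = b"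
    using assms unfolding cut_count_def by blast
  have "(R \<union> B - X) \<inter> R = R - X \<inter> R" "(R \<union> B - X) \<inter> B = B - X \<inter> B" by auto
  then have "card ((R \<union> B - X) \<inter> R) = card R - r" "card ((R \<union> B - X) \<inter> B) = card B - b"
    using X finite_R finite_B by (simp_all add: card_Diff_subset_Int Int_commute)
  then show ?thesis using cut_complement[OF X(1)] unfolding cut_count_def by blast
qed

lemma cut_count_bounds:
  assumes "cut_count r b" shows "r \<le> card R" "b \<le> card B"
  using assms finite_R finite_B unfolding cut_count_def by (auto intro: card_mono)

lemma cut_count_path:
  obtains n \<rho> \<beta> where "unit_path n \<rho> \<beta>" "\<rho> n = card R" "\<beta> n = card B" "\<And>i. cut_count (\<rho> i) (\<beta> i)"
proof -
  have "axis 1 1 \<noteq> (0 :: point)" by simp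
  then obtain xs :: "point list" where xs: "set xs = R \<union> B" "distinct xs"
    "\<And>i. halfplane_cut (R \<union> B) (set (take i xs))"
    using exists_sweep[OF finite_RB] by metis
  let ?f = "\<lambda>A i. card (set (take i xs) \<inter> A)"
  show thesis
  proof (rule that[of "length xs" "?f R" "?f B"])
    show "?f R (length xs) = card R" "?f B (length xs) = card B"
      using xs(1) by (simp_all add: Int_Un_distrib2 Un_Int_eq inf_commute)
    have "?f R (Suc i) = Suc (?f R i) \<and> ?f B (Suc i) = ?f B i \<or>
      ?f R (Suc i) = ?f R i \<and> ?f B (Suc i) = Suc (?f B i)" if "i < length xs" for i
    proof -
      have "xs ! i \<in> R \<union> B" using xs(1) that by auto
      then show ?thesis using card_take_Suc_Int[OF xs(2) that] disjoint by auto
    qed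
    then show "unit_path (length xs) (?f R) (?f B)" unfolding unit_path_def by simp
    show "cut_count (?f R i) (?f B i)" for i unfolding cut_count_def using xs(3) by blast
  qed
qed

text \<open>Move the line backwards: a shorter prefix of the same sweep has the required blue count
  and no more red points.\<close>

lemma cut_count_smaller:
  assumes "cut_count r b" "b' \<le> b"
  obtains r' where "r' \<le> r" "cut_count r' b'"
proof -
  obtain X where X: "halfplane_cut (R \<union> B) X" "card (X \<inter> R) = r" "card (X \<inter> B) = b"
    using assms unfolding cut_count_def by blast
  obtain xs m where xs: "set xs = R \<union> B" "distinct xs" "\<And>i. halfplane_cut (R \<union> B) (set (take i xs))"
    "m \<le> length xs" "X = set (take m xs)"
    using cut_is_sweep_prefix[OF finite_RB X(1)] by metis
  obtain i where "i \<le> m" "card (set (take i xs) \<inter> B) = b'"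
    using unit_step_intermediate_value[of "\<lambda>i. card (set (take i xs) \<inter> B)" 0 m b'] X xs assms
      card_take_Int_step[OF xs(2)] by auto
  then show thesis using that card_take_Int_mono[of i m xs R] X xs unfolding cut_count_def by auto
qed

text \<open>On the complementary side enlarging becomes shrinking.\<close>

lemma cut_count_larger:
  assumes "cut_count r b" "b \<le> b'" "b' \<le> card B"
  obtains r' where "r \<le> r'" "cut_count r' b'"
proof -
  obtain s where s: "s \<le> card R - r" "cut_count s (card B - b')"
    using cut_count_smaller[OF cut_count_complement[OF assms(1)], of "card B - b'"] assms(2) by force
  then have "cut_count (card R - s) b'" using cut_count_complement[OF s(2)] assms(3) by simp
  then show thesis using that[of "card R - s"] s(1) cut_count_bounds[OF assms(1)] by simp
qed

text \<open>Rotate the line. If no cut has the counts \<open>r\<close> and \<open>b\<close>, the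
  directions with too many and those with too few red points form two open, disjoint, nonempty sets
  covering the punctured plane, which is connected.\<close>

lemma cut_count_intermediate:
  assumes "cut_count r1 b" "cut_count r2 b" "r1 \<le> r" "r \<le> r2" "0 < b" "b < card B"
  shows "cut_count r b"
proof (rule ccontr)
  assume no: "\<not> cut_count r b"
  \<comment> \<open>\<open>U1\<close> stands for too many red points and \<open>U2\<close> for too
    few. Mixing \<open><\<close> and \<open>\<le>\<close> makes both open: only points strictly on
    one side of the level \<open>c\<close> have to stay there.\<close>
  define U1 where "U1 = {u. \<exists>c. card {x \<in> B. u \<bullet> x \<le> c} \<le> b \<and> r < card {x \<in> R. u \<bullet> x < c}}"
  define U2 where "U2 = {u. \<exists>c. b \<le> card {x \<in> B. u \<bullet> x < c} \<and> card {x \<in> R. u \<bullet> x \<le> c} < r}"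
  \<comment> \<open>While a single sweep keeps \<open>b\<close> blue points, its red count cannot
    pass \<open>r\<close> without producing the excluded cut.\<close>
  have no_sweep: False
    if xs: "distinct xs" "\<And>i. halfplane_cut (R \<union> B) (set (take i xs))" and "i \<le> j"
      and b: "card (set (take i xs) \<inter> B) = b" "card (set (take j xs) \<inter> B) = b"
      and r: "card (set (take i xs) \<inter> R) \<le> r" "r \<le> card (set (take j xs) \<inter> R)" for xs i j
  proof -
    obtain m where m: "i \<le> m" "m \<le> j" "card (set (take m xs) \<inter> R) = r"
      using unit_step_intermediate_value[OF card_take_Int_step[OF xs(1)] \<open>i \<le> j\<close> r] by blast
    then have "card (set (take m xs) \<inter> B) = b"
      using card_take_Int_mono[of i m xs B] card_take_Int_mono[of m j xs B] b by simp
    then show False using no m xs(2) unfolding cut_count_def by blast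
  qed
  have "open U1"
    unfolding open_subopen[of U1]
  proof
    fix u assume "u \<in> U1"
    then obtain c where c: "card {x \<in> B. u \<bullet> x \<le> c} \<le> b" "r < card {x \<in> R. u \<bullet> x < c}"
      unfolding U1_def by blast
    \<comment> \<open>Finitely many strict inequalities preserve both counts in the required sense,
      with the same level \<open>c\<close>.\<close>
    let ?T = "(\<Inter>x\<in>{x \<in> B. c < u \<bullet> x}. {v. c < v \<bullet> x}) \<inter> (\<Inter>x\<in>{x \<in> R. u \<bullet> x < c}. {v. v \<bullet> x < c})"
    have "open ?T"
      using finite_R finite_B by (intro open_Int open_INT ballI open_Collect_less continuous_intros) auto
    moreover have "?T \<subseteq> U1"
    proof
      fix v assume v: "v \<in> ?T"
      have "card {x \<in> B. v \<bullet> x \<le> c} \<le> card {x \<in> B. u \<bullet> x \<le> c}"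
        using v finite_B by (intro card_mono) (auto simp: not_le[symmetric])
      moreover have "card {x \<in> R. u \<bullet> x < c} \<le> card {x \<in> R. v \<bullet> x < c}"
        using v finite_R by (intro card_mono) auto
      ultimately show "v \<in> U1" using c unfolding U1_def by (intro CollectI exI[of _ c]) auto
    qed
    ultimately show "\<exists>T. open T \<and> u \<in> T \<and> T \<subseteq> U1" by (intro exI[of _ ?T]) auto
  qed
  have "open U2"
    unfolding open_subopen[of U2]
  proof
    fix u assume "u \<in> U2"
    then obtain c where c: "b \<le> card {x \<in> B. u \<bullet> x < c}" "card {x \<in> R. u \<bullet> x \<le> c} < r"
      unfolding U2_def by blast
    let ?T = "(\<Inter>x\<in>{x \<in> R. c < u \<bullet> x}. {v. c < v \<bullet> x}) \<inter> (\<Inter>x\<in>{x \<in> B. u \<bullet> x < c}. {v. v \<bullet> x < c})"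
    have "open ?T"
      using finite_R finite_B by (intro open_Int open_INT ballI open_Collect_less continuous_intros) auto
    moreover have "?T \<subseteq> U2"
    proof
      fix v assume v: "v \<in> ?T"
      have "card {x \<in> R. v \<bullet> x \<le> c} \<le> card {x \<in> R. u \<bullet> x \<le> c}"
        using v finite_R by (intro card_mono) (auto simp: not_le[symmetric])
      moreover have "card {x \<in> B. u \<bullet> x < c} \<le> card {x \<in> B. v \<bullet> x < c}"
        using v finite_B by (intro card_mono) auto
      ultimately show "v \<in> U2" using c unfolding U2_def by (intro CollectI exI[of _ c]) auto
    qed
    ultimately show "\<exists>T. open T \<and> u \<in> T \<and> T \<subseteq> U2" by (intro exI[of _ ?T]) auto
  qed
  have "False" if u: "u \<noteq> 0" "u \<in> U1" "u \<in> U2" for u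
  proof -
    obtain c1 where c1: "card {x \<in> B. u \<bullet> x \<le> c1} \<le> b" "r < card {x \<in> R. u \<bullet> x < c1}"
      using u(2) unfolding U1_def by blast
    obtain c2 where c2: "b \<le> card {x \<in> B. u \<bullet> x < c2}" "card {x \<in> R. u \<bullet> x \<le> c2} < r"
      using u(3) unfolding U2_def by blast
    \<comment> \<open>Between the two levels the blue count is then constantly \<open>b\<close>,
      while the red count climbs from below \<open>r\<close> to above \<open>r\<close>, against
      \<open>no_sweep\<close>.\<close>
    have "c2 < c1"
    proof (rule ccontr)
      assume "\<not> c2 < c1"
      then have "card {x \<in> R. u \<bullet> x < c1} \<le> card {x \<in> R. u \<bullet> x \<le> c2}"
        using finite_R by (intro card_mono) auto
      then show False using c1 c2 by simp
    qed
    have blue: "card {x \<in> B. u \<bullet> x \<le> c2} = b" "card {x \<in> B. u \<bullet> x < c1} = b"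
    proof -
      have "card {x \<in> B. u \<bullet> x < c2} \<le> card {x \<in> B. u \<bullet> x \<le> c2}"
        "card {x \<in> B. u \<bullet> x \<le> c2} \<le> card {x \<in> B. u \<bullet> x < c1}"
        "card {x \<in> B. u \<bullet> x < c1} \<le> card {x \<in> B. u \<bullet> x \<le> c1}"
        using finite_B \<open>c2 < c1\<close> by (auto intro!: card_mono)
      then show "card {x \<in> B. u \<bullet> x \<le> c2} = b" "card {x \<in> B. u \<bullet> x < c1} = b"
        using c1(1) c2(1) by simp_all
    qed
    obtain xs where xs: "set xs = R \<union> B" "distinct xs" "sorted (map ((\<bullet>) u) xs)"
      "\<And>i. halfplane_cut (R \<union> B) (set (take i xs))"
      using exists_sweep[OF finite_RB u(1)] by metis
    define i where "i = length (takeWhile (\<lambda>x. u \<bullet> x \<le> c2) xs)"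
    define j where "j = length (takeWhile (\<lambda>x. u \<bullet> x < c1) xs)"
    have i: "set (take i xs) = {x \<in> R \<union> B. u \<bullet> x \<le> c2}"
      using sorted_set_takeWhile[OF xs(3), of "\<lambda>x. u \<bullet> x \<le> c2"] xs(1)
      by (auto simp: i_def takeWhile_eq_take[symmetric])
    have j: "set (take j xs) = {x \<in> R \<union> B. u \<bullet> x < c1}"
      using sorted_set_takeWhile[OF xs(3), of "\<lambda>x. u \<bullet> x < c1"] xs(1)
      by (auto simp: j_def takeWhile_eq_take[symmetric])
    have len: "i \<le> length xs" "j \<le> length xs" by (auto simp: i_def j_def length_takeWhile_le)
    have "card (set (take i xs)) \<le> card (set (take j xs))"
      unfolding i j using \<open>c2 < c1\<close> finite_RB by (intro card_mono) auto
    then have "i \<le> j" using xs(2) len by (simp add: distinct_card)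
    have eqs: "{x \<in> R \<union> B. P x} \<inter> R = {x \<in> R. P x}" "{x \<in> R \<union> B. P x} \<inter> B = {x \<in> B. P x}" for P
      by auto
    show False
      using no_sweep[OF xs(2,4) \<open>i \<le> j\<close>] c1 c2 blue unfolding i j eqs by simp
  qed
  then have dis: "U1 \<inter> U2 \<inter> - {0} = {}" by auto
  have cover: "u \<in> U1 \<union> U2" if u: "u \<noteq> 0" for u
  proof -
    obtain xs where xs: "set xs = R \<union> B" "distinct xs" "sorted (map ((\<bullet>) u) xs)"
      "\<And>i. halfplane_cut (R \<union> B) (set (take i xs))"
      using exists_sweep[OF finite_RB u] by metis
    have mono: "u \<bullet> (xs ! i) \<le> u \<bullet> (xs ! j)" if "i \<le> j" "j < length xs" for i j
      using sorted_nth_mono[OF xs(3), of i j] that by simp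
    \<comment> \<open>The blue points number \<open>b\<close> and \<open>b + 1\<close> of the sweep
      are located as \<open>xs ! i\<close> and \<open>xs ! j\<close>; the prefixes of length
      \<open>Suc i\<close> to \<open>j\<close> hold exactly \<open>b\<close> blue points.\<close>
    have BS: "B \<subseteq> set xs" and b1: "b - 1 < card B" using xs(1) assms(5,6) by auto
    obtain i where i': "i < length xs" "xs ! i \<in> B" "card (set (take i xs) \<inter> B) = b - 1"
      "card (set (take (Suc i) xs) \<inter> B) = Suc (b - 1)"
      using nth_hit_in_list[OF xs(2) finite_B BS b1] by blast
    then have i: "i < length xs" "xs ! i \<in> B" "card (set (take i xs) \<inter> B) = b - 1"
      "card (set (take (Suc i) xs) \<inter> B) = b" using assms(5) by auto
    obtain j where j: "j < length xs" "xs ! j \<in> B" "card (set (take j xs) \<inter> B) = b"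
      using nth_hit_in_list[OF xs(2) finite_B BS assms(6)] by blast
    have "i < j" using card_take_Int_mono[of j i xs B] i(3) j(3) assms(5) by (cases "i < j") auto
    \<comment> \<open>If these two blue points are on one level, general position keeps every red
      point off it. This is what leaves room for the level \<open>c\<close> below.\<close>
    have triple: "u \<bullet> x \<noteq> u \<bullet> (xs ! i)" if "x \<in> R" "u \<bullet> (xs ! i) = u \<bullet> (xs ! j)" for x
    proof
      assume "u \<bullet> x = u \<bullet> (xs ! i)"
      moreover have "xs ! i \<noteq> xs ! j" using \<open>i < j\<close> j(1) xs(2) by (simp add: nth_eq_iff_index_eq)
      moreover have "x \<noteq> xs ! i" "x \<noteq> xs ! j" using that i j disjoint by auto
      ultimately show False
        using level_line_at_most_two[OF general_pos \<open>u \<noteq> 0\<close>, of x "xs ! i" "xs ! j"] that i j by auto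
    qed
    have "card (set (take j xs) \<inter> R) < r \<or> r < card (set (take (Suc i) xs) \<inter> R)"
      using no_sweep[OF xs(2,4), of "Suc i" j] i(4) j(3) \<open>i < j\<close> by force
    then show ?thesis
    proof
      assume less: "card (set (take j xs) \<inter> R) < r"
      have "u \<bullet> (xs ! i) < u \<bullet> x" if x: "x \<in> R - set (take j xs)" for x
      proof -
        obtain l where l: "l < length xs" "x = xs ! l" using x xs(1) by (metis DiffD1 UnI1 in_set_conv_nth)
        then have "j \<le> l" using x nth_in_set_take[of l j xs] by (cases "l < j") auto
        then have "u \<bullet> (xs ! j) \<le> u \<bullet> x" "u \<bullet> (xs ! i) \<le> u \<bullet> (xs ! j)"
          using mono l \<open>i < j\<close> j(1) by auto
        then show ?thesis using triple[of x] x by force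
      qed
      \<comment> \<open>A level just above \<open>xs ! i\<close> has at least \<open>b\<close> blue
        points below it and still avoids all red points outside the prefix of length
        \<open>j\<close>.\<close>
      then obtain c where c: "u \<bullet> (xs ! i) < c" "\<And>x. x \<in> R - set (take j xs) \<Longrightarrow> c < u \<bullet> x"
        using exists_strictly_below_finite[of "R - set (take j xs)" "u \<bullet> (xs ! i)" "(\<bullet>) u"] finite_R by blast
      have "set (take (Suc i) xs) \<inter> B \<subseteq> {x \<in> B. u \<bullet> x < c}"
      proof
        fix x assume x: "x \<in> set (take (Suc i) xs) \<inter> B"
        then obtain l where "l \<le> i" "x = xs ! l" by (auto simp: in_set_conv_nth less_Suc_eq_le)
        then show "x \<in> {x \<in> B. u \<bullet> x < c}" using mono[of l i] i(1) c(1) x by auto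
      qed
      then have "b \<le> card {x \<in> B. u \<bullet> x < c}" using card_mono[of "{x \<in> B. u \<bullet> x < c}"] finite_B i(4) by force
      moreover have "card {x \<in> R. u \<bullet> x \<le> c} \<le> card (set (take j xs) \<inter> R)"
        using c(2) finite_R by (intro card_mono) (auto simp: not_le[symmetric])
      ultimately have "u \<in> U2" using less unfolding U2_def by (intro CollectI exI[of _ c]) auto
      then show ?thesis ..
    next
      assume more: "r < card (set (take (Suc i) xs) \<inter> R)"
      have "u \<bullet> x < u \<bullet> (xs ! j)" if x: "x \<in> set (take (Suc i) xs) \<inter> R" for x
      proof -
        obtain l where "l \<le> i" "x = xs ! l" using x by (auto simp: in_set_conv_nth less_Suc_eq_le)
        then have "u \<bullet> x \<le> u \<bullet> (xs ! i)" "u \<bullet> (xs ! i) \<le> u \<bullet> (xs ! j)"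
          using mono i(1) \<open>i < j\<close> j(1) by auto
        then show ?thesis using triple[of x] x by force
      qed
      \<comment> \<open>The mirror image: \<open>- c\<close> is a level just below
        \<open>xs ! j\<close>, obtained by negating all values.\<close>
      then obtain c where c: "- (u \<bullet> (xs ! j)) < c" "\<And>x. x \<in> set (take (Suc i) xs) \<inter> R \<Longrightarrow> c < - (u \<bullet> x)"
        using exists_strictly_below_finite[of "set (take (Suc i) xs) \<inter> R" "- (u \<bullet> (xs ! j))" "\<lambda>x. - (u \<bullet> x)"]
        by auto
      have "{x \<in> B. u \<bullet> x \<le> - c} \<subseteq> set (take j xs) \<inter> B"
      proof
        fix x assume x: "x \<in> {x \<in> B. u \<bullet> x \<le> - c}"
        then obtain l where l: "l < length xs" "x = xs ! l" using xs(1) by (metis (no_types, lifting) UnI2 in_set_conv_nth mem_Collect_eq)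
        have "l < j" using mono[of j l] l x c(1) by force
        then show "x \<in> set (take j xs) \<inter> B" using l x nth_in_set_take[of l j xs] by auto
      qed
      then have "card {x \<in> B. u \<bullet> x \<le> - c} \<le> b" using card_mono[of "set (take j xs) \<inter> B"] j(3) by force
      moreover have "card (set (take (Suc i) xs) \<inter> R) \<le> card {x \<in> R. u \<bullet> x < - c}"
        using c(2) finite_R by (intro card_mono) force+
      ultimately have "u \<in> U1" using more unfolding U1_def by (intro CollectI exI[of _ "- c"]) auto
      then show ?thesis ..
    qed
  qed
  \<comment> \<open>A cut with normal vector \<open>0\<close> has either no blue point or all of
    them, which \<open>0 < b\<close> and \<open>b < card B\<close> exclude.\<close>
  have nonzero: "u \<noteq> 0" if "X = {x \<in> R \<union> B. u \<bullet> x < c}" "card (X \<inter> B) = b" for X u c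
  proof
    assume "u = 0"
    then have "X \<inter> B = (if 0 < c then B else {})" using that by auto
    then show False using that(2) assms(5,6) by (auto split: if_splits)
  qed
  have "U2 \<inter> - {0} \<noteq> {}"
  proof -
    obtain X where X: "halfplane_cut (R \<union> B) X" "card (X \<inter> R) = r1" "card (X \<inter> B) = b"
      using assms(1) unfolding cut_count_def by blast
    then obtain u c where u: "X = {x \<in> R \<union> B. u \<bullet> x < c}" "\<forall>x\<in>R \<union> B. u \<bullet> x \<noteq> c"
      unfolding halfplane_cut_def by blast
    have "X \<inter> R = {x \<in> R. u \<bullet> x \<le> c}" "X \<inter> B = {x \<in> B. u \<bullet> x < c}" using u by (auto simp: le_less)
    moreover have "r1 < r" using assms(1,3) no by (metis le_neq_implies_less)
    ultimately show ?thesis using X nonzero[OF u(1) X(3)] unfolding U2_def by auto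
  qed
  moreover have "U1 \<inter> - {0} \<noteq> {}"
  proof -
    obtain X where X: "halfplane_cut (R \<union> B) X" "card (X \<inter> R) = r2" "card (X \<inter> B) = b"
      using assms(2) unfolding cut_count_def by blast
    then obtain u c where u: "X = {x \<in> R \<union> B. u \<bullet> x < c}" "\<forall>x\<in>R \<union> B. u \<bullet> x \<noteq> c"
      unfolding halfplane_cut_def by blast
    have "X \<inter> B = {x \<in> B. u \<bullet> x \<le> c}" "X \<inter> R = {x \<in> R. u \<bullet> x < c}" using u by (auto simp: le_less)
    moreover have "r < r2" using assms(2,4) no by (metis le_neq_implies_less)
    ultimately show ?thesis using X nonzero[OF u(1) X(3)] unfolding U1_def by auto
  qed
  moreover have "connected (- {0 :: point})" by (rule connected_punctured_universe) simp
  ultimately show False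
    using connectedD[OF _ \<open>open U1\<close> \<open>open U2\<close> dis] cover by blast
qed

text \<open>Some line through two blue points has \<open>j\<close> blue points on one side; shifting
  it to either side of the two leaves the red count unchanged. Otherwise the first
  \<open>j + 1\<close> blue points are well defined in every direction, hence constant by
  connectedness, but opposite directions give different sets.\<close>

lemma cut_count_blue_edge:
  assumes "j + 2 \<le> card B"
  obtains r where "cut_count r j" "cut_count r (j + 2)"
proof -
  define F where "F = {T. T \<subseteq> B \<and> card T = Suc j}"
  define U where "U T = {u :: point. \<forall>x\<in>T. \<forall>y\<in>B - T. u \<bullet> x < u \<bullet> y}" for T
  have "open (U T)" if "T \<in> F" for T
  proof -
    have "finite T" using that finite_B by (auto simp: F_def intro: finite_subset)
    have "U T = (\<Inter>x\<in>T. \<Inter>y\<in>B - T. {u. u \<bullet> x < u \<bullet> y})" by (auto simp: U_def)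
    also have "open \<dots>"
      using \<open>finite T\<close> finite_B by (intro open_INT ballI open_Collect_less continuous_intros) auto
    finally show ?thesis .
  qed
  have disj: "U T \<inter> U T' = {}" if T: "T \<in> F" "T' \<in> F" "T \<noteq> T'" for T T'
  proof -
    have fin: "finite T" "finite T'" using T finite_B by (auto simp: F_def intro: finite_subset)
    have "\<not> T \<subseteq> T'" "\<not> T' \<subseteq> T"
      using card_subset_eq[OF fin(1)] card_subset_eq[OF fin(2)] T by (auto simp: F_def)
    then obtain x y where xy: "x \<in> T - T'" "y \<in> T' - T" by blast
    then have "x \<in> B - T'" "y \<in> B - T" using T by (auto simp: F_def)
    then have "u \<bullet> x < u \<bullet> y \<and> u \<bullet> y < u \<bullet> x" if "u \<in> U T" "u \<in> U T'" for u
      using that xy unfolding U_def by blast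
    then show ?thesis by fastforce
  qed
  have "\<exists>u c. u \<noteq> 0 \<and> card {x \<in> B. u \<bullet> x < c} = j \<and> card {x \<in> B. u \<bullet> x \<le> c} = j + 2 \<and> (\<forall>x\<in>R. u \<bullet> x \<noteq> c)"
  proof (rule ccontr)
    assume no: "\<not> ?thesis"
    have cover: "\<exists>T\<in>F. u \<in> U T" if u: "u \<noteq> 0" for u
    proof -
      obtain xs where xs: "set xs = B" "distinct xs" "sorted (map ((\<bullet>) u) xs)"
        using exists_sweep[OF finite_B u] by metis
      have len: "length xs = card B" using xs distinct_card by fastforce
      have mono: "u \<bullet> (xs ! i) \<le> u \<bullet> (xs ! j)" if "i \<le> j" "j < length xs" for i j
        using sorted_nth_mono[OF xs(3), of i j] that by simp
      have nth_ne: "xs ! i \<noteq> xs ! l" if "i < l" "l < length xs" for i l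
        using that xs(2) by (simp add: nth_eq_iff_index_eq)
      have inB: "xs ! i \<in> B" if "i < length xs" for i using that xs(1) by auto
      show ?thesis
      \<comment> \<open>Indices start at \<open>0\<close>: either a gap follows the first
        \<open>j + 1\<close> blue points, or the two points around this gap share a level and span
        the desired line.\<close>
      proof (cases "u \<bullet> (xs ! j) < u \<bullet> (xs ! Suc j)")
        case True
        have "u \<in> U (set (take (Suc j) xs))"
          unfolding U_def
        proof (intro CollectI ballI)
          fix x y assume x: "x \<in> set (take (Suc j) xs)" and y: "y \<in> B - set (take (Suc j) xs)"
          obtain i where i: "i \<le> j" "x = xs ! i" using x by (auto simp: in_set_conv_nth less_Suc_eq_le)
          obtain l where l: "l < length xs" "y = xs ! l" using y xs(1) by (metis DiffD1 in_set_conv_nth)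
          have "Suc j \<le> l" using y l nth_in_set_take[of l "Suc j" xs] by (cases "l < Suc j") auto
          then show "u \<bullet> x < u \<bullet> y"
            using mono[of i j] mono[of "Suc j" l] i l True by (auto simp: Suc_le_eq)
        qed
        moreover have "set (take (Suc j) xs) \<in> F"
          using xs(1,2) len assms by (auto simp: F_def distinct_card dest: in_set_takeD)
        ultimately show ?thesis by blast
      next
        case False
        define c where "c = u \<bullet> (xs ! j)"
        have j1: "Suc j < length xs" using len assms by simp
        have c: "u \<bullet> (xs ! Suc j) = c" using False mono[of j "Suc j"] j1 by (auto simp: c_def)
        have two: "x = xs ! j \<or> x = xs ! Suc j" if "x \<in> R \<union> B" "u \<bullet> x = c" for x
        proof -
          have "xs ! j \<in> R \<union> B" "xs ! Suc j \<in> R \<union> B" "xs ! j \<noteq> xs ! Suc j"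
            using inB[of j] inB[of "Suc j"] nth_ne[of j "Suc j"] j1 by simp_all
          then show ?thesis
            using level_line_at_most_two[OF general_pos u, of "xs ! j" x "xs ! Suc j"] that c c_def by metis
        qed
        have "{x \<in> B. u \<bullet> x < c} = set (take j xs)"
        proof (intro equalityI subsetI)
          fix x assume x: "x \<in> {x \<in> B. u \<bullet> x < c}"
          then obtain l where l: "l < length xs" "x = xs ! l" using xs(1) by (metis (no_types, lifting) in_set_conv_nth mem_Collect_eq)
          then have "l < j" using mono[of j l] x c_def by force
          then show "x \<in> set (take j xs)" using l nth_in_set_take[of l j xs] by auto
        next
          fix x assume x: "x \<in> set (take j xs)"
          then obtain l where l: "l < j" "x = xs ! l" by (auto simp: in_set_conv_nth)
          then have "u \<bullet> x \<le> c" "x \<in> B" "x \<noteq> xs ! j" "x \<noteq> xs ! Suc j"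
            using mono[of l j] j1 c_def inB nth_ne by auto
          then show "x \<in> {x \<in> B. u \<bullet> x < c}" using two[of x] by force
        qed
        moreover have "card (set (take j xs)) = j" using xs(2) j1 by (simp add: distinct_card)
        moreover have "{x \<in> B. u \<bullet> x \<le> c} = {x \<in> B. u \<bullet> x < c} \<union> {xs ! j, xs ! Suc j}"
          using two c c_def inB j1 by force
        moreover have "card ({x \<in> B. u \<bullet> x < c} \<union> {xs ! j, xs ! Suc j}) = card {x \<in> B. u \<bullet> x < c} + 2"
          using finite_B c c_def nth_ne[of j "Suc j"] j1 by (subst card_Un_disjoint) auto
        moreover have "\<forall>x\<in>R. u \<bullet> x \<noteq> c" using two inB j1 disjoint by (metis Suc_lessD UnI1 disjoint_iff)
        ultimately show ?thesis using no \<open>u \<noteq> 0\<close> by (metis (no_types, lifting))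
      qed
    qed
    define u0 :: point where "u0 = axis 1 1"
    have u0: "u0 \<noteq> 0" by (simp add: u0_def)
    obtain T where T: "T \<in> F" "u0 \<in> U T" using cover[OF u0] by blast
    \<comment> \<open>\<open>U T\<close> and the union of all other classes separate the punctured
      plane, since \<open>u0\<close> and \<open>- u0\<close> lie in different classes.\<close>
    let ?V = "\<Union>T'\<in>F - {T}. U T'"
    have "T \<noteq> {}" "B - T \<noteq> {}"
      using T(1) assms by (auto simp: F_def dest: card_mono[rotated])
    then obtain x y where xy: "x \<in> T" "y \<in> B - T" by blast
    have "- u0 \<notin> U T"
    proof
      assume "- u0 \<in> U T"
      then have "- u0 \<bullet> x < - u0 \<bullet> y" "u0 \<bullet> x < u0 \<bullet> y" using T(2) xy unfolding U_def by blast+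
      then show False by simp
    qed
    then have V: "- u0 \<in> ?V" using cover[of "- u0"] u0 by auto
    have conn: "connected (- {0 :: point})" by (rule connected_punctured_universe) simp
    have opn: "open (U T)" "open ?V" using T \<open>\<And>T. T \<in> F \<Longrightarrow> open (U T)\<close> by auto
    have "U T \<inter> ?V \<inter> - {0} = {}" using disj T(1) by blast
    moreover have "- {0} \<subseteq> U T \<union> ?V" using cover by blast
    ultimately have "U T \<inter> - {0} = {} \<or> ?V \<inter> - {0} = {}" by (rule connectedD[OF conn opn])
    moreover have "u0 \<in> U T \<inter> - {0}" "- u0 \<in> ?V \<inter> - {0}" using T(2) V u0 by auto
    ultimately show False by (metis empty_iff)
  qed
  then obtain u c where u: "card {x \<in> B. u \<bullet> x < c} = j" "card {x \<in> B. u \<bullet> x \<le> c} = j + 2"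
    "\<forall>x\<in>R. u \<bullet> x \<noteq> c" by blast
  have eqs: "{x \<in> R \<union> B. P x} \<inter> R = {x \<in> R. P x}" "{x \<in> R \<union> B. P x} \<inter> B = {x \<in> B. P x}" for P
    by auto
  have le_eq: "{x \<in> R. u \<bullet> x \<le> c} = {x \<in> R. u \<bullet> x < c}" using u(3) by (auto simp: le_less)
  show thesis
  proof (rule that)
    show "cut_count (card {x \<in> R. u \<bullet> x < c}) j"
      unfolding cut_count_def
      by (intro exI[of _ "{x \<in> R \<union> B. u \<bullet> x < c}"] conjI cut_less finite_RB) (simp_all only: eqs u)
    show "cut_count (card {x \<in> R. u \<bullet> x < c}) (j + 2)"
      unfolding cut_count_def
      by (intro exI[of _ "{x \<in> R \<union> B. u \<bullet> x \<le> c}"] conjI cut_le finite_RB) (simp_all only: eqs u le_eq)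
  qed
qed

lemma bichromatic_swap: "bichromatic B R"
  using finite_R finite_B disjoint general_pos by unfold_locales (auto simp: Un_commute)

lemma cut_count_swap: "bichromatic.cut_count B R b r \<longleftrightarrow> cut_count r b"
  unfolding bichromatic.cut_count_def[OF bichromatic_swap] cut_count_def by (auto simp: Un_commute)

lemma cut_count_red_edge:
  assumes "j + 2 \<le> card R"
  obtains b where "cut_count j b" "cut_count (j + 2) b"
  using bichromatic.cut_count_blue_edge[OF bichromatic_swap assms] unfolding cut_count_swap by blast

end

section \<open>Existence of a splitting line\<close>

text \<open>Side condition under which a line with \<open>r\<close> red and \<open>b\<close> blue points on one side splits the
  problem with parameters \<open>k\<close> and \<open>t\<close> into two smaller solvable ones: the sides have parameters
  \<open>(a, 0)\<close> and \<open>(k - a, t)\<close>, or \<open>(a, 1)\<close> and \<open>(k - a, t - 1)\<close>, or one side carries \<open>r\<close> stars with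
  red centers only.\<close>

definition good_cut :: "nat \<Rightarrow> nat \<Rightarrow> nat \<Rightarrow> nat \<Rightarrow> bool" where
  "good_cut k t r b \<longleftrightarrow>
     (\<exists>a. 1 \<le> a \<and> a < k \<and> t \<le> 2 * (k - a) \<and> r = 3 * a \<and> b = a) \<or>
     (\<exists>a. 1 \<le> a \<and> a < k \<and> t \<le> 2 * (k - a) + 1 \<and> r = 3 * a - 1 \<and> b = a + 2) \<or>
     1 \<le> r \<and> 3 * r \<le> b \<and> b \<le> 5 * r \<and> b \<le> r + 2 * t"

text \<open>In the plane of counts, the region between \<open>\<beta> = 3 * \<rho>\<close> and
  \<open>\<beta> = 5 * \<rho>\<close> up to \<open>\<beta> = \<rho> + 2 * t\<close> with
  \<open>\<rho> \<ge> 1\<close> consists of good cuts. A path that avoids it must pass above it and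
  meets the last line only beyond its corner at \<open>\<rho> = t\<close>.\<close>

lemma unit_path_passes_above:
  assumes path: "unit_path n \<rho> \<beta>" and ends: "\<rho> n = 3 * k - t" "\<beta> n = k + 2 * t" and t: "1 \<le> t" "t < k"
    and no: "\<And>i. i \<le> n \<Longrightarrow> \<not> good_cut k t (\<rho> i) (\<beta> i)"
    and start: "\<And>i. i \<le> n \<Longrightarrow> 1 \<le> \<rho> i \<Longrightarrow> 3 \<le> \<beta> i"
  obtains j where "j \<le> n" "t < \<rho> j" "\<beta> j = \<rho> j + 2 * t" "\<And>i. i \<le> j \<Longrightarrow> \<rho> i \<le> 3 * \<beta> i"
proof -
  let ?P = "\<lambda>i. i \<le> n \<and> 1 \<le> \<rho> i \<and> \<beta> i \<le> 5 * \<rho> i"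
  \<comment> \<open>The first entry into the wedge \<open>\<beta> \<le> 5 * \<rho>\<close> after a
    red point has occurred.\<close>
  define i where "i = (LEAST i. ?P i)"
  have "?P n" using ends t by auto
  then have i: "?P i" unfolding i_def by (rule LeastI)
  have below_i: "\<not> ?P l" if "l < i" for l using not_less_Least[of l ?P] that i_def by auto
  have "i \<noteq> 0" using i path unfolding unit_path_def by (cases "i = 0") auto
  then obtain m where m: "i = Suc m" using not0_implies_Suc by blast
  have m_not: "\<rho> m = 0 \<or> 5 * \<rho> m < \<beta> m" using below_i[of m] m i by auto
  have "m < n" using m i by simp
  \<comment> \<open>The entering step is red. If it brings the first red point, \<open>start\<close>
    supplies three blue ones; otherwise \<open>\<beta> m > 5 * \<rho> m\<close> with
    \<open>\<rho> m \<ge> 1\<close> leaves enough slack.\<close>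
  have "3 * \<rho> i \<le> \<beta> i"
  proof (cases rule: unit_path_step[OF path \<open>m < n\<close>, case_names red blue])
    case red
    then show ?thesis using m_not start[of i] i m by (cases "\<rho> m = 0") auto
  next
    case blue
    then show ?thesis using m_not i m by auto
  qed
  then have above_i: "\<rho> i + 2 * t < \<beta> i" using no[of i] i unfolding good_cut_def by auto
  let ?Q = "\<lambda>j. i \<le> j \<and> j \<le> n \<and> \<beta> j \<le> \<rho> j + 2 * t"
  define j where "j = (LEAST j. ?Q j)"
  have "?Q n" using ends t i by auto
  then have j: "?Q j" unfolding j_def by (rule LeastI)
  have below_j: "\<not> ?Q l" if "l < j" for l using not_less_Least[of l ?Q] that j_def by auto
  have "j \<noteq> i" using j above_i by (cases "j = i") auto
  then obtain l where l: "j = Suc l" "i \<le> l" using j by (metis Suc_leI le_neq_implies_less not0_implies_Suc not_less_eq_eq zero_le)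
  have l_not: "\<rho> l + 2 * t < \<beta> l" using below_j[of l] l j by auto
  have "l < n" using l j by simp
  have eq: "\<beta> j = \<rho> j + 2 * t"
    by (cases rule: unit_path_step[OF path \<open>l < n\<close>]) (use l l_not j in auto)
  have "\<rho> i \<le> \<rho> j" using unit_path_mono[OF path] j by auto
  \<comment> \<open>For \<open>\<rho> j \<le> t\<close> the cut would be good:
    \<open>3 * \<rho> j \<le> \<rho> j + 2 * t\<close>, and
    \<open>2 * t < 4 * \<rho> i \<le> 4 * \<rho> j\<close> gives
    \<open>\<beta> j \<le> 5 * \<rho> j\<close>.\<close>
  then have "t < \<rho> j" using no[of j] j eq above_i i unfolding good_cut_def by auto
  moreover have "\<rho> l \<le> 3 * \<beta> l" if lj: "l \<le> j" for l
  proof -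
    consider "l < i" | "i \<le> l" "l < j" | "l = j" using lj by linarith
    then show ?thesis
    proof cases
      case 1
      then show ?thesis using below_i[of l] i by auto
    next
      case 2
      then show ?thesis using below_j[of l] j by auto
    next
      case 3
      then show ?thesis using eq by simp
    qed
  qed
  ultimately show thesis using that j eq by blast
qed

context bichromatic
begin

lemma cut_count_one_sided:
  assumes "\<not> cut_count r b" "0 < b" "b < card B"
  shows "(\<forall>s. cut_count s b \<longrightarrow> s < r) \<or> (\<forall>s. cut_count s b \<longrightarrow> r < s)"
proof (rule ccontr)
  assume "\<not> ?thesis"
  then obtain s s' where "cut_count s b" "r \<le> s" "cut_count s' b" "s' \<le> r" by (auto simp: not_less)
  then show False using cut_count_intermediate[of s' b s r] assms by blast
qed

text \<open>Every sweep starts with three blue points, from either end. Passing above the good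
  region from both ends forces the path to cross the line \<open>\<rho> = 3 * \<beta>\<close> in
  between, which gives a good cut of the first kind.\<close>

lemma exists_good_cut_if_blue_outside:
  assumes cards: "card R = 3 * k - t" "card B = k + 2 * t" and t: "1 \<le> t" "t < k"
    and outside: "\<And>r. cut_count r 3 \<Longrightarrow> r = 0"
  shows "\<exists>r b. cut_count r b \<and> good_cut k t r b"
proof (rule ccontr)
  assume "\<not> ?thesis"
  then have no: "\<not> good_cut k t r b" if "cut_count r b" for r b using that by blast
  obtain n \<rho> \<beta> where path: "unit_path n \<rho> \<beta>" and ends: "\<rho> n = card R" "\<beta> n = card B"
    and cuts: "\<And>i. cut_count (\<rho> i) (\<beta> i)" using cut_count_path by blast
  have start: "3 \<le> b" if r: "cut_count r b" "1 \<le> r" for r b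
  proof (rule ccontr)
    assume "\<not> 3 \<le> b"
    then obtain r' where "r \<le> r'" "cut_count r' 3" using cut_count_larger[OF r(1), of 3] cards t by auto
    then show False using outside[of r'] r(2) by simp
  qed
  obtain j where j: "j \<le> n" "t < \<rho> j" "\<beta> j = \<rho> j + 2 * t" "\<And>i. i \<le> j \<Longrightarrow> \<rho> i \<le> 3 * \<beta> i"
    using unit_path_passes_above[OF path ends[unfolded cards] t no[OF cuts] start[OF cuts]] by blast
  let ?\<rho> = "\<lambda>i. \<rho> n - \<rho> (n - i)" and ?\<beta> = "\<lambda>i. \<beta> n - \<beta> (n - i)"
  have rev_cuts: "cut_count (?\<rho> i) (?\<beta> i)" for i using cut_count_complement[OF cuts] ends by simp
  have rev_ends: "?\<rho> n = 3 * k - t" "?\<beta> n = k + 2 * t" using path ends cards by (simp_all add: unit_path_def)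
  obtain j' where j': "j' \<le> n" "t < ?\<rho> j'" "?\<beta> j' = ?\<rho> j' + 2 * t"
    using unit_path_passes_above[OF unit_path_reverse[OF path] rev_ends t no[OF rev_cuts] start[OF rev_cuts]]
    by blast
  \<comment> \<open>The position found by the reversed sweep, counted from the front; there
    \<open>\<rho> q\<close> exceeds \<open>3 * \<beta> q\<close>.\<close>
  define q where "q = n - j'"
  have le: "\<rho> q \<le> \<rho> n" "\<beta> q \<le> \<beta> n" using unit_path_mono[OF path, of q n] by (auto simp: q_def)
  have "t < \<rho> n - \<rho> q" "\<beta> n - \<beta> q = \<rho> n - \<rho> q + 2 * t" unfolding q_def using j' by blast+
  then have q: "q \<le> n" "\<rho> q + t < \<rho> n" "\<beta> n + \<rho> q = \<rho> n + \<beta> q + 2 * t"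
    using le unfolding q_def by linarith+
  then have q': "3 * \<beta> q < \<rho> q" using ends cards t le by linarith
  \<comment> \<open>Up to \<open>j\<close> the path satisfies
    \<open>\<rho> \<le> 3 * \<beta>\<close>, and at \<open>q\<close> the opposite strict inequality;
    the first later index with \<open>3 * \<beta> \<le> \<rho>\<close> gives equality.\<close>
  let ?P = "\<lambda>m. j \<le> m \<and> 3 * \<beta> m \<le> \<rho> m"
  have "j < q" using j(4)[of q] q' by (cases "q \<le> j") auto
  define m where "m = (LEAST m. ?P m)"
  have "?P q" using \<open>j < q\<close> q' by simp
  then have m: "?P m" "m \<le> q" unfolding m_def by (rule LeastI, rule Least_le)
  have "m \<noteq> j" using m j(2,3) by auto
  then obtain l where l: "m = Suc l" "j \<le> l" using m(1) by (metis Suc_leI le_neq_implies_less not0_implies_Suc not_less_eq_eq zero_le)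
  have "\<not> ?P l" using not_less_Least[of l ?P] l m_def by auto
  then have l_not: "\<rho> l < 3 * \<beta> l" using l by simp
  have "l < n" using l m q by simp
  have eq: "\<rho> m = 3 * \<beta> m"
    by (cases rule: unit_path_step[OF path \<open>l < n\<close>]) (use l l_not m in auto)
  have "\<rho> m \<le> \<rho> q" "\<beta> j \<le> \<beta> m" using unit_path_mono[OF path] m q by auto
  then have "1 \<le> \<beta> m" "3 * \<beta> m + 2 * t < 3 * k" using eq q(2) ends cards j t by auto
  then have "good_cut k t (\<rho> m) (\<beta> m)" unfolding good_cut_def using eq t by auto
  then show False using no cuts by blast
qed

text \<open>Below the smallest \<open>p\<close> for which every cut with \<open>p\<close> blue points has too few red points, every
  cut has too many. If \<open>p \<ge> 2\<close>, this forces all cuts with \<open>p - 1\<close> to \<open>p + 2\<close> blue points to have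
  exactly \<open>3 * p - 2\<close> red points, which a line through two red points refutes.\<close>

lemma exists_good_cut:
  assumes cards: "card R = 3 * k - t" "card B = k + 2 * t" and t: "1 \<le> t" "t < k"
  shows "\<exists>r b. cut_count r b \<and> good_cut k t r b"
proof (rule ccontr)
  assume contr: "\<not> ?thesis"
  then have no: "\<not> good_cut k t r b" if "cut_count r b" for r b using that by blast
  \<comment> \<open>Half of \<open>t\<close>, rounded up: \<open>a \<le> k - c\<close> ensures
    \<open>t \<le> 2 * (k - a)\<close>, so that \<open>3 * a\<close> red and \<open>a\<close> blue
    points form a good cut for \<open>a \<ge> 1\<close>.\<close>
  define c where "c = (t + 1) div 2"
  have c: "t \<le> 2 * c" "2 * c \<le> t + 1" by (auto simp: c_def)
  define few where "few a \<longleftrightarrow> (\<forall>r. cut_count r a \<longrightarrow> r < 3 * a)" for a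
  have many: "3 * a < r" if "1 \<le> a" "a \<le> k - c" "\<not> few a" "cut_count r a" for a r
  proof -
    have "good_cut k t (3 * a) a" unfolding good_cut_def using that c t by auto
    then have "\<not> cut_count (3 * a) a" using no by blast
    moreover have "0 < a" "a < card B" using that cards t by auto
    ultimately show ?thesis using cut_count_one_sided[of "3 * a" a] that unfolding few_def by blast
  qed
  have "\<exists>a. 1 \<le> a \<and> a \<le> k - c \<and> few a"
  proof (rule ccontr)
    assume none: "\<not> ?thesis"
    \<comment> \<open>A cut with \<open>2 * t + c\<close> blue points has \<open>k - c\<close> blue
      points on its other side. Shrinking it to \<open>d\<close> blue points brings both sides into
      the range of \<open>many\<close>, and together they would need more red points than there
      are.\<close>
    define d where "d = min (k - c) (2 * t + c)"
    have d: "1 \<le> d" "d \<le> k - c" "d \<le> 2 * t + c" using c t by (auto simp: d_def)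
    obtain n \<rho> \<beta> where path: "unit_path n \<rho> \<beta>" "\<And>i. cut_count (\<rho> i) (\<beta> i)" using cut_count_path by blast
    then have "cut_count 0 0" using path(2)[of 0] by (simp add: unit_path_def)
    then obtain r where r: "cut_count r (2 * t + c)" using cut_count_larger[of 0 0 "2 * t + c"] cards c t by force
    then obtain s where s: "s \<le> r" "cut_count s d" using cut_count_smaller[of r "2 * t + c" d] d by auto
    have "3 * d < s" using many[of d s] none d s by auto
    moreover have "3 * (k - c) < card R - r"
      using many[of "k - c" "card R - r"] none c t cut_count_complement[OF r] cards by auto
    ultimately show False using s(1) cards c t by (auto simp: d_def min_def split: if_splits)
  qed
  then obtain p where p: "1 \<le> p" "p \<le> k - c" "few p" "\<And>a. a < p \<Longrightarrow> 1 \<le> a \<Longrightarrow> \<not> few a"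
    using exists_least_iff[of "\<lambda>a. 1 \<le> a \<and> a \<le> k - c \<and> few a"] by auto
  have p_bounds: "p + 2 < card B" "3 * p - 3 + 2 \<le> card R" using p(1,2) cards c t by auto
  \<comment> \<open>A line through two blue points transfers the upper bound on red points from
    \<open>p\<close> to some cut with \<open>p + 2\<close> blue points.\<close>
  obtain r where r: "cut_count r p" "cut_count r (p + 2)"
    using cut_count_blue_edge[of p] p_bounds(1) by (metis less_imp_le)
  have "r < 3 * p" using p(3) r(1) by (simp add: few_def)
  have G2: "good_cut k t (3 * p - 1) (p + 2)"
    unfolding good_cut_def using p c t by (intro disjI2 disjI1 exI[of _ p]) auto
  show False
  proof (cases "p = 1")
    case True
    \<comment> \<open>One star with a red center. Excluding \<open>1\<close> and \<open>2\<close>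
      red points next to three blue ones leaves \<open>0\<close>, and one-sidedness extends this to
      all cuts with three blue points.\<close>
    have "good_cut k t 1 3" using t by (simp add: good_cut_def)
    then have no13: "\<not> cut_count 1 3" using no by blast
    have p3: "p + 2 = 3" "3 * p - 1 = 2" using True by simp_all
    have r3: "cut_count r 3" using r(2) unfolding p3 .
    have "r \<noteq> 2" "r \<noteq> 1" using no[OF r3] G2[unfolded p3] \<open>good_cut k t 1 3\<close> by auto
    then have "r = 0" using \<open>r < 3 * p\<close> True by simp
    then have "s = 0" if "cut_count s 3" for s
      using cut_count_one_sided[OF no13] r3 that cards t by force
    then show False using exists_good_cut_if_blue_outside[OF cards t] contr by blast
  next
    case False
    then have p2: "2 \<le> p" using p(1) by simp
    have lower: "3 * (p - 1) < s" if "cut_count s (p - 1)" for s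
      using many[of "p - 1" s] p p2 that by auto
    obtain s where s: "s \<le> r" "cut_count s (p - 1)" using cut_count_smaller[OF r(1), of "p - 1"] by auto
    have "r \<noteq> 3 * p - 1" using no[OF r(2)] G2 by auto
    then have "r < 3 * p - 1" using \<open>r < 3 * p\<close> by simp
    moreover have "\<not> cut_count (3 * p - 1) (p + 2)" using no G2 by blast
    ultimately have upper: "s < 3 * p - 1" if "cut_count s (p + 2)" for s
      using cut_count_one_sided[of "3 * p - 1" "p + 2"] r(2) that p_bounds(1) by force
    have "3 * p - 3 + 2 = 3 * p - 1" using p2 by simp
    \<comment> \<open>A line through two red points. If \<open>b\<close> is at least
      \<open>p - 1\<close>, shrinking its smaller side contradicts \<open>lower\<close>; otherwise
      enlarging the other cut contradicts \<open>upper\<close>.\<close>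
    then obtain b where b: "cut_count (3 * p - 3) b" "cut_count (3 * p - 1) b"
      using cut_count_red_edge[OF p_bounds(2)] by metis
    show False
    proof (cases "p - 1 \<le> b")
      case True
      then obtain s where "s \<le> 3 * p - 3" "cut_count s (p - 1)" using cut_count_smaller[OF b(1)] by blast
      then show False using lower[of s] by simp
    next
      case False
      then obtain s where "3 * p - 1 \<le> s" "cut_count s (p + 2)"
        using cut_count_larger[OF b(2), of "p + 2"] p_bounds(1) by force
      then show False using upper[of s] by simp
    qed
  qed
qed

end

section \<open>Noncrossing stars\<close>

lemma noncrossingD:
  assumes "noncrossing E" "(p, q) \<in> E" "(u, v) \<in> E" "(p, q) \<noteq> (u, v)"
  shows "closed_segment p q \<inter> closed_segment u v \<subseteq> {p, q} \<inter> {u, v}"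
  using pairwiseD[OF assms(1)[unfolded noncrossing_def] assms(2-4)] by simp

lemma segments_meet_at_common_end:
  fixes a b c x :: point
  assumes "\<not> collinear {a, b, c}" "x \<in> closed_segment a b" "x \<in> closed_segment a c"
  shows "x = a"
proof (rule ccontr)
  assume "x \<noteq> a"
  have "collinear {a, x, b}" "collinear {a, x, c}"
    using assms(2,3) by (auto simp: between_mem_segment[symmetric] intro: between_imp_collinear)
  then have "collinear {a, b, c}"
    using collinear_3_trans[of b a x c] \<open>x \<noteq> a\<close> by (simp add: insert_commute)
  then show False using assms(1) by simp
qed

text \<open>Take an assignment of minimal total length. If segments to different centers met,
  exchanging their leaves would not increase the length, and equality would put the meeting point on
  both new segments, hence at both centers.\<close>

lemma shortest_assignment_noncrossing:
  assumes "finite L" "finite C" "L \<inter> C = {}" "general_position (L \<union> C)" "card L = 3 * card C"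
  obtains g where "g ` L \<subseteq> C" "\<And>c. c \<in> C \<Longrightarrow> card {l \<in> L. g l = c} = 3" "noncrossing {(g l, l) | l. l \<in> L}"
proof -
  define G where "G = {g \<in> L \<rightarrow>\<^sub>E C. \<forall>c\<in>C. card {l \<in> L. g l = c} = 3}"
  define cost where "cost g = (\<Sum>l\<in>L. dist (g l) l)" for g :: "point \<Rightarrow> point"
  have "finite G" unfolding G_def 
    by (rule finite_subset[OF _ finite_PiE[of L "\<lambda>_. C"]]) (use assms(1,2) in auto)
  have "G \<noteq> {}"
  proof -
    \<comment> \<open>A bijection onto three slots per center provides an initial
      assignment.\<close>
    have "card L = card (C \<times> {..<3::nat})" using assms(5) by (simp add: card_cartesian_product)
    then obtain h where h: "bij_betw h L (C \<times> {..<3::nat})"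
      using finite_same_card_bij[of L "C \<times> {..<3::nat}"] assms(1,2) by auto
    have "card {l \<in> L. fst (h l) = c} = 3" if "c \<in> C" for c
    proof -
      have "h ` {l \<in> L. fst (h l) = c} = {y \<in> h ` L. fst y = c}" by auto
      also have "\<dots> = {c} \<times> {..<3}" unfolding bij_betw_imp_surj_on[OF h] using that by auto
      finally have "h ` {l \<in> L. fst (h l) = c} = {c} \<times> {..<3}" .
      moreover have "inj_on h {l \<in> L. fst (h l) = c}"
        using bij_betw_imp_inj_on[OF h] by (auto intro: inj_on_subset)
      ultimately show ?thesis using card_image by fastforce
    qed
    then have "restrict (fst \<circ> h) L \<in> G"
      using bij_betwE[OF h] unfolding G_def by (auto simp: conj_commute cong: conj_cong)
    then show ?thesis by blast
  qed
  then have "Min (cost ` G) \<in> cost ` G" using \<open>finite G\<close> by simp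
  then obtain g where g: "g \<in> G" and "cost g = Min (cost ` G)" by force
  then have min: "cost g \<le> cost g'" if "g' \<in> G" for g' using \<open>finite G\<close> that by simp
  have gC: "g l \<in> C" if "l \<in> L" for l using g that by (auto simp: G_def)
  have ncol: "\<not> collinear {a, b, c}" if "a \<in> L \<union> C" "b \<in> L \<union> C" "c \<in> L \<union> C" "a \<noteq> b" "a \<noteq> c" "b \<noteq> c" for a b c
    using assms(4) that unfolding general_position_def by blast
  have "closed_segment (g l) l \<inter> closed_segment (g m) m \<subseteq> {g l, l} \<inter> {g m, m}"
    if lm: "l \<in> L" "m \<in> L" "l \<noteq> m" for l m
  proof (cases "g l = g m")
    case True
    have "\<not> collinear {g l, l, m}" using ncol[of "g l" l m] gC lm assms(3) by (metis UnCI disjoint_iff)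
    then show ?thesis using segments_meet_at_common_end True by auto
  next
    case False
    have "x \<notin> closed_segment (g m) m" if x: "x \<in> closed_segment (g l) l" for x
    proof
      assume x': "x \<in> closed_segment (g m) m"
      \<comment> \<open>Exchanging \<open>l\<close> and \<open>m\<close> permutes the leaves, so
        every center keeps three of them.\<close>
      define g' where "g' = g \<circ> Transposition.transpose l m"
      have g'_eq: "g' l = g m" "g' m = g l" "\<And>z. z \<noteq> l \<Longrightarrow> z \<noteq> m \<Longrightarrow> g' z = g z"
        by (simp_all add: g'_def)
      have in_L: "Transposition.transpose l m z \<in> L" if "z \<in> L" for z
        using that lm by (simp add: Transposition.transpose_def)
      have "card {z \<in> L. g' z = c} = 3" if "c \<in> C" for c
      proof -
        have "{z \<in> L. g' z = c} = Transposition.transpose l m ` {z \<in> L. g z = c}"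
        proof (intro equalityI subsetI)
          fix z assume "z \<in> {z \<in> L. g' z = c}"
          then have "Transposition.transpose l m z \<in> {z \<in> L. g z = c}" using in_L by (auto simp: g'_def)
          then show "z \<in> Transposition.transpose l m ` {z \<in> L. g z = c}"
            by (rule image_eqI[rotated]) simp
        qed (use in_L in \<open>auto simp: g'_def\<close>)
        also have "card \<dots> = card {z \<in> L. g z = c}" by (intro card_image inj_on_subset[OF inj_transpose]) auto
        finally show ?thesis using g that by (auto simp: G_def)
      qed
      moreover have "g' \<in> L \<rightarrow>\<^sub>E C"
        using g lm gC by (auto simp: G_def g'_def PiE_iff extensional_def Transposition.transpose_def)
      ultimately have "g' \<in> G" unfolding G_def by blast
      have split: "cost h = (\<Sum>z\<in>L - {l} - {m}. dist (h z) z) + dist (h l) l + dist (h m) m" for h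
        unfolding cost_def using lm assms(1) by (simp add: sum.remove[of L l] sum.remove[of "L - {l}" m])
      have "(\<Sum>z\<in>L - {l} - {m}. dist (g' z) z) = (\<Sum>z\<in>L - {l} - {m}. dist (g z) z)"
        by (intro sum.cong) (auto simp: g'_eq)
      then have "dist (g l) l + dist (g m) m \<le> dist (g m) l + dist (g l) m"
        using min[OF \<open>g' \<in> G\<close>] unfolding split[of g] split[of g'] g'_eq by simp
      moreover have "dist (g l) l = dist (g l) x + dist x l" "dist (g m) m = dist (g m) x + dist x m"
        using x x' by (auto simp: between_mem_segment[symmetric] between)
      \<comment> \<open>Minimality bounds the sum from below, the triangle inequality bounds each
        summand from above; so both are equalities.\<close>
      ultimately have "dist (g m) l = dist (g m) x + dist x l" "dist (g l) m = dist (g l) x + dist x m"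
        using dist_triangle[of "g m" l x] dist_triangle[of "g l" m x] by linarith+
      then have "x \<in> closed_segment (g m) l" "x \<in> closed_segment (g l) m"
        by (auto simp: between_mem_segment[symmetric] between)
      moreover have "\<not> collinear {g l, l, m}" "\<not> collinear {g m, l, m}"
        using ncol[of "g l" l m] ncol[of "g m" l m] gC lm assms(3) by (metis UnCI disjoint_iff)+
      ultimately have "x = g l" "x = g m" using segments_meet_at_common_end x x' by metis+
      then show False using False by simp
    qed
    then show ?thesis by blast
  qed
  then have "noncrossing {(g l, l) | l. l \<in> L}" unfolding noncrossing_def pairwise_def by auto
  then show thesis using that[of g] g gC unfolding G_def by auto
qed

section \<open>Coverings by stars and their combination\<close>

lemma K13_coverable_commute: "K13_coverable R B X \<longleftrightarrow> K13_coverable B R X"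
  unfolding K13_coverable_def K13_part_def by (simp add: disj_commute)

lemma K13_coverable_mono:
  assumes "K13_coverable R B X" "R \<subseteq> R'" "B \<subseteq> B'"
  shows "K13_coverable R' B' X"
proof -
  have "K13_part R' B' c Y" if "K13_part R B c Y" for c Y
    using that assms(2,3) unfolding K13_part_def by blast
  then show ?thesis using assms(1) unfolding K13_coverable_def by blast
qed

lemma K13_coverable_by_shortest_assignment:
  assumes "finite L" "finite C" "L \<inter> C = {}" "general_position (L \<union> C)" "card L = 3 * card C"
  shows "K13_coverable L C (L \<union> C)"
proof -
  obtain g where g: "g ` L \<subseteq> C" "\<And>c. c \<in> C \<Longrightarrow> card {l \<in> L. g l = c} = 3" "noncrossing {(g l, l) | l. l \<in> L}"
    using shortest_assignment_noncrossing[OF assms] by blast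
  define star where "star c = insert c {l \<in> L. g l = c}" for c
  \<comment> \<open>The center depends on the part as a set; it is recovered as the only point of
    the part in \<open>C\<close>.\<close>
  define ctr where "ctr Y = the_elem (Y \<inter> C)" for Y
  have ctr: "ctr (star c) = c" if "c \<in> C" for c
  proof -
    have "star c \<inter> C = {c}" using that assms(3) by (auto simp: star_def)
    then show ?thesis by (simp add: ctr_def)
  qed
  have minus: "star c - {c} = {l \<in> L. g l = c}" if "c \<in> C" for c
    using that assms(3) by (auto simp: star_def)
  have "partition_on (L \<union> C) (star ` C)"
  proof (rule partition_onI)
    show "\<Union> (star ` C) = L \<union> C" using g(1) by (auto simp: star_def)
    show "disjnt p q" if "p \<in> star ` C" "q \<in> star ` C" "p \<noteq> q" for p q
      using that assms(3) by (auto simp: star_def disjnt_def)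
    show "{} \<notin> star ` C" by (auto simp: star_def)
  qed
  moreover have "K13_part L C (ctr Y) Y" if Y: "Y \<in> star ` C" for Y
  proof -
    obtain c where c: "c \<in> C" "Y = star c" using Y by blast
    then have "c \<notin> {l \<in> L. g l = c}" using assms(3) by auto
    then have "card Y = 4" using c g(2)[OF c(1)] assms(1) by (simp add: star_def)
    then show ?thesis using c minus ctr by (auto simp: K13_part_def star_def)
  qed
  moreover have "{(ctr Y, p) | Y p. Y \<in> star ` C \<and> p \<in> Y - {ctr Y}} = {(g l, l) | l. l \<in> L}"
  proof (intro equalityI subsetI)
    fix e assume "e \<in> {(ctr Y, p) | Y p. Y \<in> star ` C \<and> p \<in> Y - {ctr Y}}"
    then obtain c p where "c \<in> C" "e = (ctr (star c), p)" "p \<in> star c - {ctr (star c)}" by blast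
    then show "e \<in> {(g l, l) | l. l \<in> L}" using ctr minus by auto
  next
    fix e assume "e \<in> {(g l, l) | l. l \<in> L}"
    then obtain l where l: "l \<in> L" "e = (g l, l)" by blast
    then have "g l \<in> C" using g(1) by auto
    then have "e = (ctr (star (g l)), l)" "l \<in> star (g l) - {ctr (star (g l))}"
      using l ctr minus[of "g l"] by auto
    then show "e \<in> {(ctr Y, p) | Y p. Y \<in> star ` C \<and> p \<in> Y - {ctr Y}}" using \<open>g l \<in> C\<close> by blast
  qed
  ultimately show ?thesis using g(3) unfolding K13_coverable_def by (intro exI[of _ "star ` C"] exI[of _ ctr]) auto
qed

text \<open>Open half-planes are convex, so edges of stars on different sides of the line cannot
  meet.\<close>

lemma K13_coverable_Un_separated:
  assumes "K13_coverable R B X1" "K13_coverable R B X2" "X1 \<subseteq> {x. u \<bullet> x < c}" "X2 \<subseteq> {x. c < u \<bullet> x}"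
  shows "K13_coverable R B (X1 \<union> X2)"
proof -
  obtain P1 ctr1 where 1: "partition_on X1 P1" "\<And>Y. Y \<in> P1 \<Longrightarrow> K13_part R B (ctr1 Y) Y"
    "noncrossing {(ctr1 Y, p) | Y p. Y \<in> P1 \<and> p \<in> Y - {ctr1 Y}}"
    using assms(1) unfolding K13_coverable_def by blast
  obtain P2 ctr2 where 2: "partition_on X2 P2" "\<And>Y. Y \<in> P2 \<Longrightarrow> K13_part R B (ctr2 Y) Y"
    "noncrossing {(ctr2 Y, p) | Y p. Y \<in> P2 \<and> p \<in> Y - {ctr2 Y}}"
    using assms(2) unfolding K13_coverable_def by blast
  have "X1 \<inter> X2 = {}" using assms(3,4) by force
  have disj: "P1 \<inter> P2 = {}"
  proof (rule ccontr)
    assume "P1 \<inter> P2 \<noteq> {}"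
    then obtain Y where Y: "Y \<in> P1" "Y \<in> P2" by blast
    then have "Y \<noteq> {}" "Y \<subseteq> X1" "Y \<subseteq> X2" using 1(1) 2(1) by (auto simp: partition_on_def)
    then show False using \<open>X1 \<inter> X2 = {}\<close> by blast
  qed
  define ctr where "ctr Y = (if Y \<in> P1 then ctr1 Y else ctr2 Y)" for Y
  have ctr: "ctr Y = ctr1 Y" if "Y \<in> P1" for Y using that by (simp add: ctr_def)
  have ctr': "ctr Y = ctr2 Y" if "Y \<in> P2" for Y using that disj by (auto simp: ctr_def)
  let ?E1 = "{(ctr1 Y, p) | Y p. Y \<in> P1 \<and> p \<in> Y - {ctr1 Y}}"
  let ?E2 = "{(ctr2 Y, p) | Y p. Y \<in> P2 \<and> p \<in> Y - {ctr2 Y}}"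
  have E: "{(ctr Y, p) | Y p. Y \<in> P1 \<union> P2 \<and> p \<in> Y - {ctr Y}} = ?E1 \<union> ?E2"
    using ctr ctr' by auto metis+
  have E1: "closed_segment p q \<subseteq> {x. u \<bullet> x < c}" if "(p, q) \<in> ?E1" for p q
  proof (rule closed_segment_subset)
    show "p \<in> {x. u \<bullet> x < c}" "q \<in> {x. u \<bullet> x < c}"
      using that 1(1,2) assms(3) by (auto simp: partition_on_def K13_part_def)
  qed (rule convex_halfspace_lt)
  have E2: "closed_segment p q \<subseteq> {x. c < u \<bullet> x}" if "(p, q) \<in> ?E2" for p q
  proof (rule closed_segment_subset)
    show "p \<in> {x. c < u \<bullet> x}" "q \<in> {x. c < u \<bullet> x}"
      using that 2(1,2) assms(4) by (auto simp: partition_on_def K13_part_def)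
  qed (rule convex_halfspace_gt)
  have cross: "closed_segment p q \<inter> closed_segment p' q' = {}" if "(p, q) \<in> ?E1" "(p', q') \<in> ?E2" for p q p' q'
    using E1[OF that(1)] E2[OF that(2)] by force
  have "noncrossing (?E1 \<union> ?E2)"
    unfolding noncrossing_def pairwise_def
  proof (intro ballI impI)
    fix e f assume ef: "e \<in> ?E1 \<union> ?E2" "f \<in> ?E1 \<union> ?E2" "e \<noteq> f"
    obtain p q p' q' where e: "e = (p, q)" "f = (p', q')" by (cases e, cases f) auto
    consider "e \<in> ?E1" "f \<in> ?E1" | "e \<in> ?E2" "f \<in> ?E2" | "e \<in> ?E1" "f \<in> ?E2" | "e \<in> ?E2" "f \<in> ?E1"
      using ef by blast
    then have "closed_segment p q \<inter> closed_segment p' q' \<subseteq> {p, q} \<inter> {p', q'}"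
    proof cases
      case 1
      then show ?thesis using noncrossingD[OF \<open>noncrossing ?E1\<close>] ef(3) unfolding e by blast
    next
      case 2
      then show ?thesis using noncrossingD[OF \<open>noncrossing ?E2\<close>] ef(3) unfolding e by blast
    next
      case 3
      then show ?thesis using cross unfolding e by blast
    next
      case 4
      then show ?thesis using cross[of p' q' p q] unfolding e by blast
    qed
    then show "(\<lambda>(p, q) (u, v). closed_segment p q \<inter> closed_segment u v \<subseteq> {p, q} \<inter> {u, v}) e f"
      unfolding e by simp
  qed
  moreover have "partition_on (X1 \<union> X2) (P1 \<union> P2)"
    using 1(1) 2(1) \<open>X1 \<inter> X2 = {}\<close> disjoint_union[of P1 P2] by (auto simp: partition_on_def)
  moreover have "\<forall>Y\<in>P1 \<union> P2. K13_part R B (ctr Y) Y" using 1(2) 2(2) ctr ctr' by auto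
  ultimately show ?thesis
    unfolding K13_coverable_def E[symmetric] by blast
qed

text \<open>The number of stars is expressed by the size of the covered set, the quantity that
  \<open>max_covered\<close> maximizes.\<close>

definition has_stars :: "point set \<Rightarrow> point set \<Rightarrow> nat \<Rightarrow> bool" where
  "has_stars R B k \<longleftrightarrow> (\<exists>X\<subseteq>R \<union> B. K13_coverable R B X \<and> card X = 4 * k)"

lemma has_stars_commute: "has_stars R B k \<longleftrightarrow> has_stars B R k"
  unfolding has_stars_def by (subst K13_coverable_commute) (simp add: Un_commute)

lemma has_stars_mono: "has_stars R B k \<Longrightarrow> R \<subseteq> R' \<Longrightarrow> B \<subseteq> B' \<Longrightarrow> has_stars R' B' k"
  unfolding has_stars_def using K13_coverable_mono by (metis (no_types, lifting) Un_mono subset_trans)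

lemma has_stars_cut:
  assumes "finite R" "finite B" "halfplane_cut (R \<union> B) X"
    and "has_stars (X \<inter> R) (X \<inter> B) k" "has_stars (R - X) (B - X) l"
  shows "has_stars R B (k + l)"
proof -
  obtain u c where X: "X = {x \<in> R \<union> B. u \<bullet> x < c}" "\<forall>x\<in>R \<union> B. u \<bullet> x \<noteq> c"
    using assms(3) unfolding halfplane_cut_def by blast
  obtain Y where Y: "Y \<subseteq> X \<inter> R \<union> X \<inter> B" "K13_coverable (X \<inter> R) (X \<inter> B) Y" "card Y = 4 * k"
    using assms(4) unfolding has_stars_def by blast
  obtain Z where Z: "Z \<subseteq> (R - X) \<union> (B - X)" "K13_coverable (R - X) (B - X) Z" "card Z = 4 * l"
    using assms(5) unfolding has_stars_def by blast
  have sub: "Y \<subseteq> {x. u \<bullet> x < c}" "Z \<subseteq> {x. c < u \<bullet> x}"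
    using X Y(1) Z(1) by force+
  have "K13_coverable R B Y" "K13_coverable R B Z"
    using K13_coverable_mono[OF Y(2)] K13_coverable_mono[OF Z(2)] by auto
  then have "K13_coverable R B (Y \<union> Z)" using K13_coverable_Un_separated sub by blast
  moreover have "Y \<union> Z \<subseteq> R \<union> B" using Y(1) Z(1) by auto
  moreover have "card (Y \<union> Z) = 4 * (k + l)"
  proof -
    have "finite Y" "finite Z" using \<open>Y \<union> Z \<subseteq> R \<union> B\<close> assms(1,2) by (auto intro: finite_subset)
    moreover have "Y \<inter> Z = {}" using Y(1) Z(1) by auto
    ultimately show ?thesis using Y(3) Z(3) by (simp add: card_Un_disjoint)
  qed
  ultimately show ?thesis unfolding has_stars_def by blast
qed

lemma general_position_subset: "general_position S \<Longrightarrow> T \<subseteq> S \<Longrightarrow> general_position T"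
  unfolding general_position_def by blast

lemma (in bichromatic) bichromatic_subset:
  assumes "R' \<subseteq> R" "B' \<subseteq> B" shows "bichromatic R' B'"
proof
  show "general_position (R' \<union> B')"
    using general_position_subset[OF general_pos] assms by blast
qed (use assms finite_R finite_B disjoint in \<open>auto intro: finite_subset\<close>)

text \<open>Discard surplus points and take a shortest assignment of red leaves to blue
  centers.\<close>

lemma (in bichromatic) has_stars_blue_centers:
  assumes "3 * k \<le> card R" "k \<le> card B"
  shows "has_stars R B k"
proof -
  obtain L where L: "L \<subseteq> R" "card L = 3 * k" using obtain_subset_with_card_n[OF assms(1)] by blast
  obtain C where C: "C \<subseteq> B" "card C = k" using obtain_subset_with_card_n[OF assms(2)] by blast
  interpret LC: bichromatic L C using bichromatic_subset L C by blast
  have "K13_coverable L C (L \<union> C)"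
    using K13_coverable_by_shortest_assignment LC.finite_R LC.finite_B LC.disjoint LC.general_pos L C by simp
  moreover have "card (L \<union> C) = 4 * k"
    using L C LC.finite_R LC.finite_B LC.disjoint by (simp add: card_Un_disjoint)
  ultimately have "has_stars L C k" unfolding has_stars_def by blast
  then show ?thesis using has_stars_mono L C by blast
qed

lemma (in bichromatic) has_stars_red_centers:
  assumes "k \<le> card R" "3 * k \<le> card B"
  shows "has_stars R B k"
proof -
  interpret swap: bichromatic B R by (rule bichromatic_swap)
  show ?thesis using swap.has_stars_blue_centers assms has_stars_commute by blast
qed

text \<open>Strong induction on \<open>k\<close> with \<open>t\<close> free, since a splitting line
  distributes \<open>t\<close> over its sides. For \<open>k \<le> t\<close> there are at least
  \<open>k\<close> red and \<open>3 * k\<close> blue points, so red centers suffice.\<close>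

lemma has_stars_if_cards:
  assumes "bichromatic R B" "3 * k \<le> card R + t" "k + 2 * t \<le> card B" "t \<le> 2 * k"
  shows "has_stars R B k"
  using assms
proof (induction k arbitrary: R B t rule: less_induct)
  case (less k)
  interpret RB: bichromatic R B by fact
  consider "t = 0" | "k \<le> t" | "1 \<le> t" "t < k" by linarith
  then show ?case
  proof cases
    case 1
    then show ?thesis using RB.has_stars_blue_centers less.prems by simp
  next
    case 2
    then show ?thesis using RB.has_stars_red_centers less.prems by simp
  next
    case 3
    \<comment> \<open>The splitting lemma asks for exact cardinalities, so surplus points are
      discarded first.\<close>
    have "3 * k - t \<le> card R" using less.prems(2) by simp
    from obtain_subset_with_card_n[OF this] obtain R' where R': "R' \<subseteq> R" "card R' = 3 * k - t"
      by blast
    obtain B' where B': "B' \<subseteq> B" "card B' = k + 2 * t"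
      using obtain_subset_with_card_n[OF less.prems(3)] by blast
    interpret S: bichromatic R' B' using RB.bichromatic_subset R' B' by blast
    obtain r b where "S.cut_count r b" and good: "good_cut k t r b"
      using S.exists_good_cut[OF R'(2) B'(2) 3] by blast
    then obtain X where X: "halfplane_cut (R' \<union> B') X" "card (X \<inter> R') = r" "card (X \<inter> B') = b"
      unfolding S.cut_count_def by blast
    have inside: "bichromatic (X \<inter> R') (X \<inter> B')" and outside: "bichromatic (R' - X) (B' - X)"
      by (auto intro: S.bichromatic_subset)
    have rb: "r \<le> 3 * k - t" "b \<le> k + 2 * t"
      using X(2,3) card_mono[of R' "X \<inter> R'"] card_mono[of B' "X \<inter> B'"] S.finite_R S.finite_B R' B' by auto
    have rest: "card (R' - X) = 3 * k - t - r" "card (B' - X) = k + 2 * t - b"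
      using X(2,3) R'(2) B'(2) S.finite_R S.finite_B by (simp_all add: card_Diff_subset_Int Int_commute)
    note combine = has_stars_cut[OF S.finite_R S.finite_B X(1)]
    have "has_stars R' B' k"
      using good unfolding good_cut_def
    proof (elim disjE exE conjE)
      fix a assume a: "1 \<le> a" "a < k" "t \<le> 2 * (k - a)" "r = 3 * a" "b = a"
      have "has_stars (X \<inter> R') (X \<inter> B') a"
        using bichromatic.has_stars_blue_centers[OF inside] X a by simp
      moreover have "has_stars (R' - X) (B' - X) (k - a)"
        by (rule less.IH[OF _ outside, of _ t]) (use rest a 3 rb in auto)
      ultimately show ?thesis using combine[of a "k - a"] a(2) by simp
    next
      fix a assume a: "1 \<le> a" "a < k" "t \<le> 2 * (k - a) + 1" "r = 3 * a - 1" "b = a + 2"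
      \<comment> \<open>One unit of \<open>t\<close> goes to this side, which has
        \<open>3 * a - 1\<close> red and \<open>a + 2\<close> blue points; the other side keeps
        \<open>t - 1\<close>.\<close>
      have "has_stars (X \<inter> R') (X \<inter> B') a"
        by (rule less.IH[OF _ inside, of _ 1]) (use X a in auto)
      moreover have "has_stars (R' - X) (B' - X) (k - a)"
        by (rule less.IH[OF _ outside, of _ "t - 1"]) (use rest a 3 rb in auto)
      ultimately show ?thesis using combine[of a "k - a"] a(2) by simp
    next
      assume a: "1 \<le> r" "3 * r \<le> b" "b \<le> 5 * r" "b \<le> r + 2 * t"
      have "has_stars (X \<inter> R') (X \<inter> B') r"
        using bichromatic.has_stars_red_centers[OF inside] X a by simp
      moreover have "has_stars (R' - X) (B' - X) (k - r)"
        \<comment> \<open>The subtraction may truncate. The bound \<open>b \<le> 5 * r\<close>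
          provides enough blue points if \<open>2 * r \<le> t\<close>, and
          \<open>b \<le> r + 2 * t\<close> does so if the difference is \<open>0\<close>.\<close>
        by (rule less.IH[OF _ outside, of _ "t - 2 * r"]) (use rest a 3 rb in auto)
      ultimately show ?thesis using combine[of r "k - r"] a 3 by simp
    qed
    then show ?thesis using has_stars_mono R'(1) B'(1) by blast
  qed
qed

section \<open>Existence of point sets and the final bound\<close>

lemma collinear_determinant:
  fixes x y z :: point
  assumes "collinear {x, y, z}"
  shows "(x - y) $ 1 * (x - z) $ 2 = (x - y) $ 2 * (x - z) $ 1"
proof -
  obtain u where "\<forall>a\<in>{x, y, z}. \<forall>b\<in>{x, y, z}. \<exists>c. a - b = c *\<^sub>R u"
    using assms unfolding collinear_def by blast
  then obtain c d where "x - y = c *\<^sub>R u" "x - z = d *\<^sub>R u" by blast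
  then show ?thesis by simp
qed

text \<open>Points on a parabola are in general position: the collinearity determinant factors into
  the pairwise differences of the abscissas.\<close>

lemma exists_rb_set: "\<exists>R B. rb_set r b R B"
proof -
  define f :: "nat \<Rightarrow> point" where "f i = vector [real i, (real i)\<^sup>2]" for i
  have f: "f i $ 1 = real i" "f i $ 2 = (real i)\<^sup>2" for i by (simp_all add: f_def)
  have inj: "inj f" by (rule injI) (metis f(1) of_nat_eq_iff)
  have "\<not> collinear {f i, f j, f l}" if "i \<noteq> j" "i \<noteq> l" "j \<noteq> l" for i j l
  proof
    assume "collinear {f i, f j, f l}"
    then have "(real i - real j) * ((real i)\<^sup>2 - (real l)\<^sup>2) = ((real i)\<^sup>2 - (real j)\<^sup>2) * (real i - real l)"
      using collinear_determinant by (fastforce simp: f)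
    then have "(real i - real j) * (real i - real l) * (real l - real j) = 0"
      by (simp add: power2_eq_square algebra_simps)
    then show False using that by simp
  qed
  then have "general_position (range f)" unfolding general_position_def by (metis rangeE)
  then have "general_position (f ` {..<r} \<union> f ` {r..<r + b})"
    by (rule general_position_subset) auto
  then have "rb_set r b (f ` {..<r}) (f ` {r..<r + b})"
    unfolding rb_set_def using inj by (auto simp: card_image inj_on_subset inj_eq)
  then show ?thesis by blast
qed

lemma uncovered_le:
  assumes "finite R" "finite B" "has_stars R B k" "card (R \<union> B) \<le> 4 * k + t"
  shows "uncovered R B \<le> t"
proof -
  have "finite {card X | X. X \<subseteq> R \<union> B \<and> K13_coverable R B X}"
    by (rule finite_subset[of _ "card ` Pow (R \<union> B)"]) (use assms(1,2) in auto)
  moreover obtain X where "X \<subseteq> R \<union> B" "K13_coverable R B X" "card X = 4 * k"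
    using assms(3) unfolding has_stars_def by blast
  then have "4 * k \<in> {card X | X. X \<subseteq> R \<union> B \<and> K13_coverable R B X}"
    by (intro CollectI exI[of _ X]) simp
  ultimately have "4 * k \<le> max_covered R B" unfolding max_covered_def by (rule Max_ge)
  then show ?thesis using assms(4) unfolding uncovered_def by simp
qed

theorem theorem13:
  fixes t k :: nat
  assumes "real k \<ge> 5 / 8 * real t"
  shows "max_uncovered (3 * k - t) (k + 2 * t) \<le> t"
proof -
  have kt: "5 * t \<le> 8 * k" using assms by linarith
  have le: "uncovered R B \<le> t" if "rb_set (3 * k - t) (k + 2 * t) R B" for R B
  proof -
    have S: "finite R" "finite B" "card R = 3 * k - t" "card B = k + 2 * t" and RB: "bichromatic R B"
      using that unfolding rb_set_def by (auto intro: bichromatic.intro)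
    \<comment> \<open>The bound \<open>5 * t \<le> 8 * k\<close> yields
      \<open>t \<le> 2 * k\<close>; in particular \<open>3 * k - t\<close> is a true
      difference.\<close>
    have "has_stars R B k" by (rule has_stars_if_cards[OF RB, of _ t]) (use S kt in auto)
    moreover have "card (R \<union> B) \<le> 4 * k + t" using card_Un_le[of R B] S kt by simp
    ultimately show ?thesis using uncovered_le S by blast
  qed
  let ?U = "{uncovered R B | R B. rb_set (3 * k - t) (k + 2 * t) R B}"
  have "?U \<subseteq> {..t}" using le by auto
  \<comment> \<open>Nonemptiness makes the maximum an element of the set.\<close>
  moreover have "?U \<noteq> {}" using exists_rb_set by blast
  ultimately show ?thesis
    unfolding max_uncovered_def by (metis (no_types, lifting) Max_in atMost_iff finite_atMost finite_subset subsetD)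
qed

end
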